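(* Let $H$ be an infinite-dimensional separable real Hilbert space with an orthonormal basis consisting of vectors $e_i$ and $f_i$, for $i\in\omega$. For $X\subseteq H$ let $[X]$ be the closed subspace of $H$ generated by $X$, and put $$a=[\{f_i\mid i\in\omega\}],\qquad b=[\{f_0\}\cup\{e_i-2f_{i+1}\mid i\in\omega\}],\qquad c=[\{e_i+f_i\mid i\in\omega\}],$$ $$M=\{\{0\},a,a^\bot,b,b^\bot,c,c^\bot,H\}.$$ Let $L$ be the set of all closed subspaces of $H$ that are congruent to some element of $M$ modulo the ideal of finite-dimensional subspaces of $H$, with the lattice operations of the lattice of closed subspaces of $H$. Then the (complemented modular) lattice $L$ is not normal.
   Context: The lattice of all closed subspaces of $H$ is ordered by inclusion, with meet $x\cap y$ and join the closure of $x+y$; $x^\bot$ is the orthogonal complement. Two closed subspaces $x,y$ are congruent modulo the ideal of finite-dimensional subspaces if there is a finite-dimensional subspace $z$ with $x+z=y+z$. It is known (Bruns and Roddy) that $L$ is a sub-ortholattice of the lattice of closed subspaces of $H$ and that $x+y$ is closed for all $x,y\in L$; hence $L$ is a complemented modular lattice, and joins in $L$ are vector space sums. In a modular lattice with zero, $x\perp y$ means $x\wedge y=0$, and $z=x\oplus y$ means $x\wedge y=0$ and $x\vee y=z$. Elements $x,y$ of a lattice are perspective, $x\sim y$, if there is $t$ with $x\wedge t=y\wedge t$ and $x\vee t=y\vee t$. A normal equivalence on a modular lattice $L$ with zero is an equivalence relation $\equiv$ on $L$ such that: (E1) $\equiv$ is additive ($x\equiv x'$, $y\equiv y'$ and both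 $x\oplus y$ and $x'\oplus y'$ defined imply $x\oplus y\equiv x'\oplus y'$) and refining (if $y\equiv x_0\oplus x_1$, then there are $y_0\equiv x_0$ and $y_1\equiv x_1$ with $y=y_0\oplus y_1$); (E2) $x\sim y$ implies $x\equiv y$; (E3) $x\perp y$ and $x\equiv y$ imply $x\sim y$. A modular lattice with zero is normal if there is at least one normal equivalence on it. *)

theory Defs
  imports "HOL-Analysis.Analysis" "HOL-Algebra.Congruence"
begin

section \<open>Modular lattices with zero and normal equivalences\<close>

text \<open>
  The lattices here live on a carrier set and carry their operations explicitly, so that a family
  of closed subspaces can be equipped with the operations of the lattice of all closed subspaces.
  The order is recovered as \<^prop>\<open>m x y = x\<close> for the meet operation \<^term>\<open>m\<close>.
\<close>

record 'a zlattice = "'a partial_object" +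
  lmeet :: "'a \<Rightarrow> 'a \<Rightarrow> 'a"
  ljoin :: "'a \<Rightarrow> 'a \<Rightarrow> 'a"
  lzero :: 'a

locale lattice_with_zero =
  fixes L :: "('a, 'm) zlattice_scheme"
  assumes meet_closed: "x \<in> carrier L \<Longrightarrow> y \<in> carrier L \<Longrightarrow> lmeet L x y \<in> carrier L"
    and join_closed: "x \<in> carrier L \<Longrightarrow> y \<in> carrier L \<Longrightarrow> ljoin L x y \<in> carrier L"
    and zero_closed: "lzero L \<in> carrier L"
    and meet_commute: "x \<in> carrier L \<Longrightarrow> y \<in> carrier L \<Longrightarrow> lmeet L x y = lmeet L y x"
    and join_commute: "x \<in> carrier L \<Longrightarrow> y \<in> carrier L \<Longrightarrow> ljoin L x y = ljoin L y x"
    and meet_assoc: "x \<in> carrier L \<Longrightarrow> y \<in> carrier L \<Longrightarrow> z \<in> carrier L \<Longrightarrow>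
        lmeet L (lmeet L x y) z = lmeet L x (lmeet L y z)"
    and join_assoc: "x \<in> carrier L \<Longrightarrow> y \<in> carrier L \<Longrightarrow> z \<in> carrier L \<Longrightarrow>
        ljoin L (ljoin L x y) z = ljoin L x (ljoin L y z)"
    and meet_join_absorb: "x \<in> carrier L \<Longrightarrow> y \<in> carrier L \<Longrightarrow> lmeet L x (ljoin L x y) = x"
    and join_meet_absorb: "x \<in> carrier L \<Longrightarrow> y \<in> carrier L \<Longrightarrow> ljoin L x (lmeet L x y) = x"
    and join_zero: "x \<in> carrier L \<Longrightarrow> ljoin L x (lzero L) = x"

locale modular_lattice_with_zero = lattice_with_zero +
  assumes modular: "x \<in> carrier L \<Longrightarrow> y \<in> carrier L \<Longrightarrow> z \<in> carrier L \<Longrightarrow> lmeet L x z = x \<Longrightarrow>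
        ljoin L x (lmeet L y z) = lmeet L (ljoin L x y) z"

locale complemented_modular_lattice = modular_lattice_with_zero +
  assumes complemented: "\<exists>u\<in>carrier L. \<forall>x\<in>carrier L. lmeet L x u = x \<and>
        (\<exists>y\<in>carrier L. lmeet L x y = lzero L \<and> ljoin L x y = u)"

definition independent_in :: "('a, 'm) zlattice_scheme \<Rightarrow> 'a \<Rightarrow> 'a \<Rightarrow> bool" where
  "independent_in L x y \<longleftrightarrow> lmeet L x y = lzero L"

text \<open>\<^term>\<open>is_direct_join L z x y\<close> renders \<open>z = x \<oplus> y\<close>.\<close>

definition is_direct_join :: "('a, 'm) zlattice_scheme \<Rightarrow> 'a \<Rightarrow> 'a \<Rightarrow> 'a \<Rightarrow> bool" where
  "is_direct_join L z x y \<longleftrightarrow> lmeet L x y = lzero L \<and> ljoin L x y = z"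

definition perspective :: "('a, 'm) zlattice_scheme \<Rightarrow> 'a \<Rightarrow> 'a \<Rightarrow> bool" where
  "perspective L x y \<longleftrightarrow>
     (\<exists>t\<in>carrier L. lmeet L x t = lmeet L y t \<and> ljoin L x t = ljoin L y t)"

definition additive_on :: "('a, 'm) zlattice_scheme \<Rightarrow> ('a \<times> 'a) set \<Rightarrow> bool" where
  "additive_on L R \<longleftrightarrow>
     (\<forall>x\<in>carrier L. \<forall>x'\<in>carrier L. \<forall>y\<in>carrier L. \<forall>y'\<in>carrier L. \<forall>z\<in>carrier L. \<forall>z'\<in>carrier L.
        (x, x') \<in> R \<longrightarrow> (y, y') \<in> R \<longrightarrow> is_direct_join L z x y \<longrightarrow> is_direct_join L z' x' y' \<longrightarrow>
        (z, z') \<in> R)"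

definition refining_on :: "('a, 'm) zlattice_scheme \<Rightarrow> ('a \<times> 'a) set \<Rightarrow> bool" where
  "refining_on L R \<longleftrightarrow>
     (\<forall>y\<in>carrier L. \<forall>z\<in>carrier L. \<forall>x\<^sub>0\<in>carrier L. \<forall>x\<^sub>1\<in>carrier L.
        (y, z) \<in> R \<longrightarrow> is_direct_join L z x\<^sub>0 x\<^sub>1 \<longrightarrow>
        (\<exists>y\<^sub>0\<in>carrier L. \<exists>y\<^sub>1\<in>carrier L.
           (y\<^sub>0, x\<^sub>0) \<in> R \<and> (y\<^sub>1, x\<^sub>1) \<in> R \<and> is_direct_join L y y\<^sub>0 y\<^sub>1))"

definition normal_equivalence :: "('a, 'm) zlattice_scheme \<Rightarrow> ('a \<times> 'a) set \<Rightarrow> bool" where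
  "normal_equivalence L R \<longleftrightarrow>
     equiv (carrier L) R \<and>
     additive_on L R \<and> refining_on L R \<and>
     (\<forall>x\<in>carrier L. \<forall>y\<in>carrier L. perspective L x y \<longrightarrow> (x, y) \<in> R) \<and>
     (\<forall>x\<in>carrier L. \<forall>y\<in>carrier L. independent_in L x y \<longrightarrow> (x, y) \<in> R \<longrightarrow> perspective L x y)"

definition normal_lattice :: "('a, 'm) zlattice_scheme \<Rightarrow> bool" where
  "normal_lattice L \<longleftrightarrow> modular_lattice_with_zero L \<and> (\<exists>R. normal_equivalence L R)"

section \<open>Closed subspaces of a Hilbert space\<close>

definition orthonormal_basis :: "('i \<Rightarrow> 'h::real_inner) \<Rightarrow> bool" where
  "orthonormal_basis g \<longleftrightarrow>
     (\<forall>i j. g i \<bullet> g j = (if i = j then 1 else 0)) \<and> closure (span (range g)) = UNIV"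

definition closed_span :: "'h::real_inner set \<Rightarrow> 'h set" where
  "closed_span X = closure (span X)"

text \<open>In the join, \<open>x + y\<close> is the elementwise sum of sets.\<close>

definition closed_subspace_lattice :: "'h::real_inner set zlattice" where
  "closed_subspace_lattice =
     \<lparr>carrier = {x. subspace x \<and> closed x},
      lmeet = (\<inter>),
      ljoin = (\<lambda>x y. closure (x + y)),
      lzero = {0}\<rparr>"

text \<open>Finite-dimensional subspaces are exactly the spans of finite sets.\<close>

definition fd_congruent :: "'h::real_inner set \<Rightarrow> 'h set \<Rightarrow> bool" where
  "fd_congruent x y \<longleftrightarrow> (\<exists>z. (\<exists>B. finite B \<and> z = span B) \<and> x + z = y + z)"

definition fd_saturation :: "'h::real_inner set set \<Rightarrow> 'h set zlattice" where
  "fd_saturation M = closed_subspace_lattice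
     \<lparr>carrier := {x \<in> carrier closed_subspace_lattice. \<exists>m\<in>M. fd_congruent x m}\<rparr>"

end

theory Submission
  imports Defs
begin

text \<open>
  Two subspaces have a \<^emph>\<open>positive angle\<close> when they meet in \<open>0\<close> and the projection of their sum onto
  one of them along the other is bounded. In a complete space the sum of two closed subspaces with a
  positive angle is closed, and this persists when either of them is changed by a
  finite-dimensional subspace (\<open>closed_set_plus_fd_congruent\<close>). So if a family of closed subspaces
  is pairwise of positive angle with sums of finite codimension, then modulo finite-dimensional
  subspaces its members are atoms any two of which are complementary, and the subspaces congruent
  to one of them, to \<open>0\<close> or to \<open>H\<close> form a complemented modular lattice in which joins are vector
  space sums (\<open>complemented_modular_saturation\<close>).

  The six proper subspaces in question have this property. Up to one dimension each of them is the
  closed span of the vectors \<open>\<alpha> e\<^sub>i + \<beta> f\<^sub>\<sigma>\<^sub>(\<^sub>i\<^sub>)\<close>, where \<open>\<sigma>\<close> is the identity or the successor, and the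
  two components of each of its vectors have norms in the ratio of \<open>\<bar>\<alpha>\<bar>\<close> to \<open>\<bar>\<beta>\<bar>\<close>. Different
  ratios force a positive angle (\<open>positive_angle_slanted\<close>), and the only two subspaces with equal
  ratios, \<open>c\<close> and its complement, are orthogonal.

  Non-normality comes from a Fredholm index. The shift in the definition of \<open>b\<close> makes \<open>a + b = H\<close>
  with \<open>a \<inter> b\<close> spanned by \<open>f\<^sub>0\<close>, so that \<open>b\<close> is a complement not of \<open>a\<close> but of its hyperplane
  \<open>a\<^sub>1 = [f\<^sub>1, f\<^sub>2, \<dots>]\<close>. Now \<open>b\<close> is a common complement of \<open>a\<^sub>1\<close> and \<open>a\<^sup>\<bottom>\<close>, then \<open>c\<close> one of \<open>a\<^sup>\<bottom>\<close> and
  \<open>a\<close>, and \<open>a\<^sup>\<bottom>\<close> one of \<open>a\<close> and \<open>b\<close>. Hence \<open>a\<^sub>1 \<equiv> b\<close> for every normal equivalence, and since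
  \<open>a\<^sub>1 \<inter> b = 0\<close>, these two would have to be perspective, that is, to have a common complement \<open>t\<close>
  in the lattice. This \<open>t\<close> is congruent to some \<open>m\<close> in the given list. If \<open>m\<close> is \<open>0\<close>, \<open>a\<close>, \<open>b\<close> or
  \<open>H\<close>, dimensions are wrong at once. Each of the remaining four is a complement of both \<open>a\<close> and
  \<open>b\<close>. Replacing \<open>m\<close> by \<open>t\<close> keeps a complement of \<open>b\<close>, so \<open>t\<close> has relative dimension \<open>0\<close> over
  \<open>m\<close>; but it must have relative dimension \<open>1\<close> to be a complement of the hyperplane \<open>a\<^sub>1\<close> of \<open>a\<close>
  (\<open>common_almost_complement_unique\<close>).
\<close>

section \<open>Linear algebra modulo finite-dimensional subspaces\<close>

lemma mem_set_plus: "w \<in> X + Y \<longleftrightarrow> (\<exists>x\<in>X. \<exists>y\<in>Y. w = x + y)"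
  by (auto simp: set_plus_def)

lemma subspace_set_plus:
  assumes "subspace X" "subspace Y"
  shows "subspace (X + Y)"
proof -
  have "X + Y = {x + y |x y. x \<in> X \<and> y \<in> Y}"
    unfolding set_plus_def by blast
  then show ?thesis using subspace_sums[OF assms] by simp
qed

lemma span_Un_set_plus: "span (B \<union> C) = span B + span C"
  by (auto simp: span_Un set_plus_def)

lemma subset_set_plus_left: "subspace Y \<Longrightarrow> X \<subseteq> X + Y"
  using set_zero_plus2[of Y X] by (simp add: subspace_0 add.commute)

lemma subset_set_plus_right: "subspace X \<Longrightarrow> Y \<subseteq> X + Y"
  using set_zero_plus2[of X Y] by (simp add: subspace_0)

lemma set_plus_subspace_least:
  "subspace Z \<Longrightarrow> X \<subseteq> Z \<Longrightarrow> Y \<subseteq> Z \<Longrightarrow> X + Y \<subseteq> Z"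
  by (clarsimp simp: mem_set_plus subset_iff subspace_add)

lemma subspace_set_plus_self: "subspace X \<Longrightarrow> X + X = X"
  by (simp add: set_plus_subspace_least subset_set_plus_left subset_antisym)

lemma mem_plus_span_insert:
  "w \<in> X + span (insert v B) \<longleftrightarrow> (\<exists>k. w - k *\<^sub>R v \<in> X + span B)"
proof
  assume "w \<in> X + span (insert v B)"
  then obtain x s k where "x \<in> X" "w = x + s" "s - k *\<^sub>R v \<in> span B"
    by (auto simp: mem_set_plus span_breakdown_eq)
  then have "w - k *\<^sub>R v = x + (s - k *\<^sub>R v)" by simp
  then show "\<exists>k. w - k *\<^sub>R v \<in> X + span B"
    using \<open>x \<in> X\<close> \<open>s - k *\<^sub>R v \<in> span B\<close> by (metis set_plus_intro)
next
  assume "\<exists>k. w - k *\<^sub>R v \<in> X + span B"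
  then obtain k x s where x: "x \<in> X" and s: "s \<in> span B" and "w - k *\<^sub>R v = x + s"
    by (auto simp: mem_set_plus)
  then have w: "w = x + (s + k *\<^sub>R v)" by (simp add: algebra_simps)
  have "s + k *\<^sub>R v \<in> span (insert v B)"
    using s by (auto simp: span_breakdown_eq intro!: exI[of _ k])
  then show "w \<in> X + span (insert v B)"
    using w x by (metis set_plus_intro)
qed

text \<open>
  The modular law holds for a finite-dimensional summand up to a change of that summand: adding one
  vector to \<open>B\<close> enlarges the left-hand side by at most one dimension, and a single new element
  \<open>w\<close> of it absorbs that dimension. All statements on intersections modulo finite-dimensional
  subspaces come from this one.
\<close>

lemma finite_extension_Int:
  assumes "subspace X" "subspace Y" "finite B"
  shows "\<exists>C. finite C \<and> C \<subseteq> Y \<and> (X + span B) \<inter> Y = (X \<inter> Y) + span C"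
  using \<open>finite B\<close>
proof (induction B rule: finite_induct)
  case empty
  show ?case by (intro exI[of _ "{}"]) (auto simp: mem_set_plus)
next
  case (insert v B)
  then obtain C where C: "finite C" "C \<subseteq> Y" "(X + span B) \<inter> Y = (X \<inter> Y) + span C" by blast
  have sB: "subspace (X + span B)" using assms by (simp add: subspace_set_plus)
  show ?case
  proof (cases "(X + span (insert v B)) \<inter> Y \<subseteq> X + span B")
    case True
    moreover have "X + span B \<subseteq> X + span (insert v B)"
      by (intro set_plus_mono2 span_mono) auto
    ultimately have "(X + span (insert v B)) \<inter> Y = (X + span B) \<inter> Y" by blast
    with C show ?thesis by auto
  next
    case False
    then obtain w where w: "w \<in> Y" "w \<notin> X + span B" "w \<in> X + span (insert v B)" by blast
    then obtain k where k: "w - k *\<^sub>R v \<in> X + span B" by (auto simp: mem_plus_span_insert)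
    with w(2) have "k \<noteq> 0" by auto
    have "(X + span (insert v B)) \<inter> Y = (X \<inter> Y) + span (insert w C)"
    proof (intro Set.set_eqI iffI)
      fix u assume "u \<in> (X + span (insert v B)) \<inter> Y"
      then obtain l where l: "u - l *\<^sub>R v \<in> X + span B" and u: "u \<in> Y"
        by (auto simp: mem_plus_span_insert)
      have "(u - l *\<^sub>R v) - (l / k) *\<^sub>R (w - k *\<^sub>R v) \<in> X + span B"
        by (intro subspace_diff[OF sB l] subspace_scale[OF sB k])
      then have "u - (l / k) *\<^sub>R w \<in> X + span B"
        using \<open>k \<noteq> 0\<close> by (simp add: algebra_simps)
      moreover have "u - (l / k) *\<^sub>R w \<in> Y"
        using u w \<open>subspace Y\<close> by (intro subspace_diff subspace_scale) auto
      ultimately show "u \<in> (X \<inter> Y) + span (insert w C)"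
        using C(3) by (auto simp: mem_plus_span_insert)
    next
      fix u assume "u \<in> (X \<inter> Y) + span (insert w C)"
      then obtain l where l: "u - l *\<^sub>R w \<in> (X + span B) \<inter> Y"
        using C(3) by (auto simp: mem_plus_span_insert)
      have "X + span B \<subseteq> X + span (insert v B)"
        by (intro set_plus_mono2 span_mono) auto
      then have "u - l *\<^sub>R w \<in> (X + span (insert v B)) \<inter> Y" using l by blast
      moreover have sub: "subspace ((X + span (insert v B)) \<inter> Y)"
        using assms by (simp add: subspace_inter subspace_set_plus)
      moreover have "l *\<^sub>R w \<in> (X + span (insert v B)) \<inter> Y"
        using w by (intro subspace_scale[OF sub]) auto
      ultimately have "u - l *\<^sub>R w + l *\<^sub>R w \<in> (X + span (insert v B)) \<inter> Y"
        by (intro subspace_add[OF sub])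
      then show "u \<in> (X + span (insert v B)) \<inter> Y" by simp
    qed
    then show ?thesis using C w by (intro exI[of _ "insert w C"]) auto
  qed
qed

text \<open>
  The order underlying congruence modulo finite-dimensional subspaces. It splits
  \<^const>\<open>fd_congruent\<close> into two one-sided conditions, and these are the ones that are monotone in
  sums and intersections.
\<close>

definition almost_in :: "'v::real_vector set \<Rightarrow> 'v set \<Rightarrow> bool" where
  "almost_in X Y \<longleftrightarrow> (\<exists>B. finite B \<and> X \<subseteq> Y + span B)"

lemma almost_in_subset: "X \<subseteq> Y \<Longrightarrow> almost_in X Y"
  unfolding almost_in_def by (rule exI[of _ "{}"]) (auto simp: mem_set_plus)

lemma almost_in_trans:
  assumes "almost_in X Y" "almost_in Y Z"
  shows "almost_in X Z"
proof -
  from assms obtain B C where "finite B" "X \<subseteq> Y + span B" "finite C" "Y \<subseteq> Z + span C"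
    unfolding almost_in_def by blast
  then have "X \<subseteq> Z + span C + span B" by (meson order_trans set_plus_mono2 order_refl)
  then have "X \<subseteq> Z + span (C \<union> B)" by (simp add: span_Un_set_plus add.assoc)
  then show ?thesis using \<open>finite B\<close> \<open>finite C\<close> unfolding almost_in_def by blast
qed

lemma almost_in_plus:
  assumes "almost_in X X'" "almost_in Y Y'"
  shows "almost_in (X + Y) (X' + Y')"
proof -
  from assms obtain B C where *: "finite B" "X \<subseteq> X' + span B" "finite C" "Y \<subseteq> Y' + span C"
    unfolding almost_in_def by blast
  then have "X + Y \<subseteq> (X' + span B) + (Y' + span C)" by (intro set_plus_mono2)
  also have "\<dots> = (X' + Y') + span (B \<union> C)" by (simp add: span_Un_set_plus ac_simps)
  finally show ?thesis using * unfolding almost_in_def by blast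
qed

lemma almost_in_Int:
  assumes "almost_in X X'" "almost_in Y Y'" "subspace X'" "subspace Y'" "subspace Y"
  shows "almost_in (X \<inter> Y) (X' \<inter> Y')"
proof -
  from assms obtain B C where *: "finite B" "X \<subseteq> X' + span B" "finite C" "Y \<subseteq> Y' + span C"
    unfolding almost_in_def by blast
  obtain B' where "finite B'" "(X' + span B) \<inter> Y = X' \<inter> Y + span B'"
    using finite_extension_Int[OF \<open>subspace X'\<close> \<open>subspace Y\<close> \<open>finite B\<close>] by blast
  then have "almost_in (X \<inter> Y) (X' \<inter> Y)"
    unfolding almost_in_def using *(2) by blast
  moreover
  obtain C' where "finite C'" "(Y' + span C) \<inter> X' = Y' \<inter> X' + span C'"
    using finite_extension_Int[OF \<open>subspace Y'\<close> \<open>subspace X'\<close> \<open>finite C\<close>] by blast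
  then have "almost_in (X' \<inter> Y) (X' \<inter> Y')"
    unfolding almost_in_def using *(4) by (metis Int_commute Int_mono order_refl)
  ultimately show ?thesis by (rule almost_in_trans)
qed

lemma fd_congruent_iff:
  assumes "subspace X" "subspace Y"
  shows "fd_congruent X Y \<longleftrightarrow> almost_in X Y \<and> almost_in Y X"
proof
  assume "fd_congruent X Y"
  then obtain B where "finite B" "X + span B = Y + span B" unfolding fd_congruent_def by blast
  then show "almost_in X Y \<and> almost_in Y X"
    using subset_set_plus_left[OF subspace_span, of X B] subset_set_plus_left[OF subspace_span, of Y B]
    unfolding almost_in_def by auto
next
  assume "almost_in X Y \<and> almost_in Y X"
  then obtain B C where *: "finite B" "X \<subseteq> Y + span B" "finite C" "Y \<subseteq> X + span C"
    unfolding almost_in_def by blast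
  have "X + span (B \<union> C) = Y + span (B \<union> C)" (is "_ + ?Z = _ + ?Z")
  proof
    have "Y + span B \<subseteq> Y + ?Z" "X + span C \<subseteq> X + ?Z"
      by (intro set_plus_mono2 span_mono; simp)+
    then have "X \<subseteq> Y + ?Z" "Y \<subseteq> X + ?Z" using *(2,4) by blast+
    then show "X + ?Z \<subseteq> Y + ?Z" "Y + ?Z \<subseteq> X + ?Z"
      using assms by (simp_all add: set_plus_subspace_least subspace_set_plus subset_set_plus_right)
  qed
  then show "fd_congruent X Y" unfolding fd_congruent_def using * by blast
qed

lemma fd_congruent_refl: "fd_congruent X X"
  unfolding fd_congruent_def by blast

lemma fd_congruent_sym: "fd_congruent X Y \<Longrightarrow> fd_congruent Y X"
  unfolding fd_congruent_def by metis

text \<open>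
  A subspace of finite codimension in \<open>X\<close> has a finite-dimensional complement in \<open>X\<close>. The size of the
  basis \<open>B\<close> is the codimension, and \<open>independent_modulo_bound\<close> compares two such sizes.
\<close>

lemma almost_complement:
  assumes "subspace D" "subspace X" "D \<subseteq> X" "almost_in X D"
  obtains B where "finite B" "independent B" "B \<subseteq> X" "span B \<inter> D = {0}" "D + span B = X"
proof -
  obtain C0 where "finite C0" "X \<subseteq> D + span C0" using assms(4) unfolding almost_in_def by blast
  obtain C
    where C: "finite C" "C \<subseteq> X" "X = D + span C"
  proof -
    obtain C where "finite C" "C \<subseteq> X" "(D + span C0) \<inter> X = (D \<inter> X) + span C"
      using finite_extension_Int[OF assms(1,2) \<open>finite C0\<close>] by blast
    moreover have "(D + span C0) \<inter> X = X" "D \<inter> X = D"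
      using \<open>X \<subseteq> D + span C0\<close> \<open>D \<subseteq> X\<close> by auto
    ultimately show thesis using that by metis
  qed
  have "\<exists>B\<subseteq>C. independent B \<and> span B \<inter> D = {0} \<and> D + span B = D + span C"
    using C(1)
  proof (induction C rule: finite_induct)
    case empty
    show ?case using assms(1) by (intro exI[of _ "{}"]) (auto simp: subspace_0 independent_empty)
  next
    case (insert v C)
    then obtain B where B: "B \<subseteq> C" "independent B" "span B \<inter> D = {0}" "D + span B = D + span C"
      by blast
    have ins: "D + span (insert v C) = D + span (insert v B)"
      using B(4) by (auto simp: mem_plus_span_insert)
    show ?case
    proof (cases "v \<in> D + span B")
      case True
      have sub: "subspace (D + span B)" using assms by (simp add: subspace_set_plus)
      have "w \<in> D + span (insert v B) \<longleftrightarrow> w \<in> D + span B" for w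
      proof
        assume "w \<in> D + span (insert v B)"
        then obtain k where "w - k *\<^sub>R v \<in> D + span B" by (auto simp: mem_plus_span_insert)
        then have "w - k *\<^sub>R v + k *\<^sub>R v \<in> D + span B"
          using sub True by (intro subspace_add subspace_scale)
        then show "w \<in> D + span B" by simp
      next
        assume "w \<in> D + span B"
        then show "w \<in> D + span (insert v B)"
          by (auto simp: mem_plus_span_insert intro!: exI[of _ 0])
      qed
      then show ?thesis using B ins by (intro exI[of _ B]) auto
    next
      case False
      then have "v \<notin> span B"
        using subset_set_plus_right[OF assms(1)] by blast
      moreover have "span (insert v B) \<inter> D = {0}"
      proof -
        have "w = 0" if w: "w \<in> span (insert v B)" "w \<in> D" for w
        proof -
          obtain k where k: "w - k *\<^sub>R v \<in> span B" using w by (auto simp: span_breakdown_eq)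
          have "k = 0"
          proof (rule ccontr)
            assume "k \<noteq> 0"
            have "v = (1/k) *\<^sub>R w + (- (1/k)) *\<^sub>R (w - k *\<^sub>R v)"
              using \<open>k \<noteq> 0\<close> by (simp add: algebra_simps)
            moreover have "(1/k) *\<^sub>R w \<in> D" "(- (1/k)) *\<^sub>R (w - k *\<^sub>R v) \<in> span B"
              using w k assms(1) by (blast intro: subspace_scale span_scale)+
            ultimately show False using False by (metis set_plus_intro)
          qed
          then show ?thesis using k w B(3) by auto
        qed
        then show ?thesis using assms(1) by (auto simp: subspace_0 span_zero)
      qed
      ultimately show ?thesis using B ins
        by (intro exI[of _ "insert v B"]) (auto simp: independent_insert)
    qed
  qed
  then show ?thesis using that C by (metis finite_subset order_trans)
qed

text \<open>
  The exchange bound in the quotient by \<open>W\<close>. Instead of forming the quotient, move every element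
  of \<open>C\<close> by an element of \<open>W\<close> into \<open>span B\<close>; the move \<open>g\<close> changes vectors of \<open>span C\<close> only by
  elements of \<open>W\<close>, so it is injective there, and the usual bound applies to the image of \<open>C\<close>.
\<close>

lemma independent_modulo_bound:
  assumes W: "subspace W" and "finite B" and C: "independent C" "span C \<inter> W = {0}"
    and CB: "C \<subseteq> W + span B"
  shows "finite C \<and> card C \<le> card B"
proof -
  have "\<exists>s. s \<in> span B \<and> c - s \<in> W" if c: "c \<in> C" for c
  proof -
    obtain x s where "x \<in> W" "s \<in> span B" "c = x + s" using c CB by (blast elim: set_plus_elim)
    then show ?thesis by (intro exI[of _ s]) auto
  qed
  then obtain s where s: "\<And>c. c \<in> C \<Longrightarrow> s c \<in> span B \<and> c - s c \<in> W" by metis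
  obtain g where g: "linear g" "\<forall>c\<in>C. g c = s c"
    using linear_independent_extend[OF C(1)] by blast
  have gW: "x - g x \<in> W" if "x \<in> span C" for x
    using that
  proof (induction rule: span_induct_alt)
    case base
    show ?case using W g by (simp add: linear_0 subspace_0)
  next
    case (step k c y)
    have "k *\<^sub>R c + y - g (k *\<^sub>R c + y) = k *\<^sub>R (c - s c) + (y - g y)"
      using g step by (simp add: linear_add linear_scale algebra_simps)
    then show ?case using W step s by (metis subspace_add subspace_scale)
  qed
  have inj: "inj_on g (span C)"
    unfolding linear_inj_on_span_iff_independent_image[OF g(1)]
  proof -
    have "x = y" if "x \<in> span C" "y \<in> span C" "g x = g y" for x y
    proof -
      have "x - y \<in> W" using gW[of "x - y"] that g by (simp add: linear_diff span_diff)
      moreover have "x - y \<in> span C" using that by (simp add: span_diff)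
      ultimately have "x - y = 0" using C(2) by blast
      then show ?thesis by simp
    qed
    then show "inj_on g (span C)" by (auto simp: inj_on_def)
  qed
  have "independent (g ` C)" by (rule linear_independent_injective_image[OF g(1) C(1) inj])
  moreover have "g ` C \<subseteq> span B" using g s by auto
  ultimately have "finite (g ` C) \<and> card (g ` C) \<le> card B"
    by (rule independent_span_bound[OF \<open>finite B\<close>])
  moreover have "inj_on g C" using inj span_superset by (rule inj_on_subset)
  ultimately show ?thesis by (simp add: card_image finite_image_iff)
qed

text \<open>
  The index argument. Let \<open>B\<close> and \<open>C\<close> be bases of complements of \<open>D = X \<inter> Y\<close> in \<open>X\<close> and in \<open>Y\<close>.
  Modulo \<open>Q + D\<close>, the set \<open>B\<close> generates everything and \<open>C\<close> is independent, so \<open>C\<close> is not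
  larger than \<open>B\<close>. Modulo \<open>P' + D\<close>, the set \<open>C\<close> generates everything, while \<open>B\<close> stays
  independent even together with a vector of \<open>P\<close> outside \<open>P'\<close>, so such a vector would make \<open>C\<close>
  strictly larger than \<open>B\<close>.
\<close>

lemma common_almost_complement_unique:
  assumes sub: "subspace P'" "subspace P" "subspace Q" "subspace X" "subspace Y"
    and XY: "almost_in X Y" "almost_in Y X"
    and Q: "Q + X = UNIV" "Q \<inter> Y = {0}"
    and P: "P' \<subseteq> P" "P' + Y = UNIV" "P \<inter> X = {0}"
  shows "P' = P"
proof (rule ccontr)
  assume "P' \<noteq> P"
  then obtain v where v: "v \<in> P" "v \<notin> P'" using P(1) by blast
  have "v \<notin> X"
  proof
    assume "v \<in> X"
    then have "v = 0" using v(1) P(3) by auto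
    then show False using v(2) subspace_0[OF sub(1)] by simp
  qed
  define D where "D = X \<inter> Y"
  have D: "subspace D" "D \<subseteq> X" "D \<subseteq> Y" "almost_in X D" "almost_in Y D"
    using sub XY almost_in_Int[of X X X Y] almost_in_Int[of Y X Y Y] unfolding D_def
    by (auto simp: subspace_inter almost_in_subset)
  obtain B where B: "finite B" "B \<subseteq> X" "independent B" "span B \<inter> D = {0}" "D + span B = X"
    using almost_complement[OF D(1) sub(4) D(2,4)] by metis
  obtain C where C: "finite C" "C \<subseteq> Y" "independent C" "span C \<inter> D = {0}" "D + span C = Y"
    using almost_complement[OF D(1) sub(5) D(3,5)] by metis
  have spX: "span B \<subseteq> X" and spY: "span C \<subseteq> Y"
    using B(2) C(2) sub by (simp_all add: span_minimal)
  have "card C \<le> card B"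
  proof -
    have "w = 0" if w: "w \<in> span C" "w \<in> Q + D" for w
    proof -
      obtain q d where qd: "q \<in> Q" "d \<in> D" "w = q + d" using w(2) by (auto simp: mem_set_plus)
      then have "q = w - d" by simp
      moreover have "w \<in> Y" "d \<in> Y" using w(1) spY qd D by auto
      ultimately have "q \<in> Y" using sub(5) by (simp add: subspace_diff)
      then have "q = 0" using qd Q(2) by blast
      then show "w = 0" using qd w(1) C(4) by auto
    qed
    then have "span C \<inter> (Q + D) = {0}"
      using sub D by (auto simp: span_zero subspace_0 subspace_set_plus)
    moreover have "C \<subseteq> Q + D + span B" using Q(1) B(5) by (simp add: add.assoc)
    ultimately show ?thesis
      using independent_modulo_bound[of "Q + D" B C] B(1) C(3) sub D by (simp add: subspace_set_plus)
  qed
  moreover have "card (insert v B) \<le> card C"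
  proof -
    have "w = 0" if w: "w \<in> span (insert v B)" "w \<in> P' + D" for w
    proof -
      obtain p d where pd: "p \<in> P'" "d \<in> D" "w = p + d" using w(2) by (auto simp: mem_set_plus)
      obtain k where k: "w - k *\<^sub>R v \<in> span B" using w by (auto simp: span_breakdown_eq)
      \<comment> \<open>This vector lies in \<open>X\<close> by its first form and in \<open>P\<close> by its second, \<open>p - k v\<close>.\<close>
      have "w - k *\<^sub>R v - d \<in> X" using k pd spX D sub(4) by (blast intro: subspace_diff)
      moreover have "w - k *\<^sub>R v - d = p - k *\<^sub>R v" using pd by simp
      ultimately have "p - k *\<^sub>R v \<in> X" by simp
      moreover have "p - k *\<^sub>R v \<in> P" using pd P(1) v sub(2) by (blast intro: subspace_diff subspace_scale)
      ultimately have 0: "p - k *\<^sub>R v = 0" using P(3) by blast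
      have "k = 0"
      proof (rule ccontr)
        assume "k \<noteq> 0"
        then have "v = (1/k) *\<^sub>R p" using 0 by (simp add: algebra_simps)
        then show False using v(2) pd(1) sub(1) by (simp add: subspace_scale)
      qed
      then have "w = d" "w \<in> span B" using 0 pd k by auto
      then show "w = 0" using pd B(4) by auto
    qed
    then have "span (insert v B) \<inter> (P' + D) = {0}"
      using sub D by (auto simp: span_zero subspace_0 subspace_set_plus)
    moreover have "insert v B \<subseteq> P' + D + span C" using P(2) C(5) by (simp add: add.assoc)
    moreover have "v \<notin> span B" using spX \<open>v \<notin> X\<close> by blast
    ultimately show ?thesis
      using independent_modulo_bound[of "P' + D" C "insert v B"] C(1) B(3) sub D
      by (simp add: subspace_set_plus independent_insert)
  qed
  moreover have "card (insert v B) = Suc (card B)" using B(1,2) \<open>v \<notin> X\<close> by (metis card_insert_disjoint subsetD)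
  ultimately show False by linarith
qed

lemma almost_in_zero_if_disjoint:
  assumes "subspace X" "subspace Y" "almost_in X Y" "X \<inter> Y = {0}"
  shows "almost_in X {0}"
  using almost_in_Int[of X Y X X] assms by (simp add: almost_in_subset Int_commute)

section \<open>Positive angles and closed sums\<close>

lemma fd_congruentI: "finite B \<Longrightarrow> X + span B = Y + span B \<Longrightarrow> fd_congruent X Y"
  unfolding fd_congruent_def by blast

lemma fd_congruent_trans:
  assumes "fd_congruent X Y" "fd_congruent Y Z"
  shows "fd_congruent X Z"
proof -
  from assms obtain B C where "finite B" "X + span B = Y + span B"
    "finite C" "Y + span C = Z + span C"
    unfolding fd_congruent_def by blast
  have "X + span (B \<union> C) = (X + span B) + span C" by (simp add: span_Un_set_plus add.assoc)
  also have "\<dots> = (Y + span C) + span B"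
    unfolding \<open>X + span B = Y + span B\<close> by (simp add: ac_simps)
  also have "\<dots> = Z + span (B \<union> C)"
    unfolding \<open>Y + span C = Z + span C\<close> by (simp add: span_Un_set_plus ac_simps)
  finally show ?thesis
    using \<open>finite B\<close> \<open>finite C\<close> by (intro fd_congruentI[of "B \<union> C"]) simp_all
qed

lemma fd_congruent_plus:
  assumes "fd_congruent X X'" "fd_congruent Y Y'"
  shows "fd_congruent (X + Y) (X' + Y')"
proof -
  from assms obtain B C where *: "finite B" "X + span B = X' + span B"
    "finite C" "Y + span C = Y' + span C"
    unfolding fd_congruent_def by blast
  have "X + Y + span (B \<union> C) = (X + span B) + (Y + span C)" by (simp add: span_Un_set_plus ac_simps)
  also have "\<dots> = X' + Y' + span (B \<union> C)"
    unfolding *(2,4) by (simp add: span_Un_set_plus ac_simps)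
  finally show ?thesis
    using *(1,3) by (intro fd_congruentI[of "B \<union> C"]) simp_all
qed

lemma fd_congruent_Int:
  assumes "fd_congruent X X'" "fd_congruent Y Y'"
    "subspace X" "subspace Y" "subspace X'" "subspace Y'"
  shows "fd_congruent (X \<inter> Y) (X' \<inter> Y')"
proof -
  have "almost_in X X'" "almost_in X' X" "almost_in Y Y'" "almost_in Y' Y"
    using assms by (simp_all add: fd_congruent_iff)
  then have "almost_in (X \<inter> Y) (X' \<inter> Y')" "almost_in (X' \<inter> Y') (X \<inter> Y)"
    using assms(3-6) by (blast intro: almost_in_Int)+
  then show ?thesis using assms(3-6) by (simp add: fd_congruent_iff subspace_inter)
qed

lemma fd_congruent_plus_finite:
  assumes "finite B"
  shows "fd_congruent (X + span B) X"
proof -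
  have "X + span B + span B = X + span B" by (simp add: add.assoc subspace_set_plus_self)
  then show ?thesis using assms by (rule fd_congruentI[rotated])
qed

text \<open>
  The bound says that the projection of \<open>X + Y\<close> onto \<open>X\<close> along \<open>Y\<close> is well defined and bounded. It
  concerns vectors only, so it can be proved on spans and carried over to closures.
\<close>

definition positive_angle :: "'v::real_normed_vector set \<Rightarrow> 'v set \<Rightarrow> bool" where
  "positive_angle X Y \<longleftrightarrow> (\<exists>K. \<forall>x\<in>X. \<forall>y\<in>Y. norm x \<le> K * norm (x + y))"

lemma positive_angle_subset:
  "positive_angle X Y \<Longrightarrow> X' \<subseteq> X \<Longrightarrow> Y' \<subseteq> Y \<Longrightarrow> positive_angle X' Y'"
  unfolding positive_angle_def by (meson subsetD)

lemma positive_angle_sym: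
  assumes "positive_angle X Y"
  shows "positive_angle Y X"
proof -
  obtain K where K: "\<And>x y. x \<in> X \<Longrightarrow> y \<in> Y \<Longrightarrow> norm x \<le> K * norm (x + y)"
    using assms unfolding positive_angle_def by blast
  have "norm y \<le> (K + 1) * norm (y + x)" if "x \<in> X" "y \<in> Y" for x y
  proof -
    have "norm y \<le> norm (x + y) + norm x" using norm_triangle_ineq4[of "x + y" x] by simp
    then show ?thesis using K[OF that] by (simp add: algebra_simps)
  qed
  then show ?thesis unfolding positive_angle_def by blast
qed

lemma positive_angle_Int:
  assumes "positive_angle X Y" "subspace X" "subspace Y"
  shows "X \<inter> Y = {0}"
proof -
  obtain K where K: "\<And>x y. x \<in> X \<Longrightarrow> y \<in> Y \<Longrightarrow> norm x \<le> K * norm (x + y)"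
    using assms unfolding positive_angle_def by blast
  have "w = 0" if "w \<in> X" "w \<in> Y" for w
    using K[of w "- w"] that assms(3) by (simp add: subspace_neg)
  then show ?thesis using assms by (auto simp: subspace_0)
qed

lemma positive_angle_closure:
  assumes "positive_angle X Y"
  shows "positive_angle (closure X) (closure Y)"
proof -
  obtain K where K: "\<And>x y. x \<in> X \<Longrightarrow> y \<in> Y \<Longrightarrow> norm x \<le> K * norm (x + y)"
    using assms unfolding positive_angle_def by blast
  have "closed {p. norm (fst p) \<le> K * norm (fst p + snd p)}"
    by (intro closed_Collect_le continuous_intros)
  moreover have "X \<times> Y \<subseteq> {p. norm (fst p) \<le> K * norm (fst p + snd p)}"
    using K by auto
  ultimately have "closure X \<times> closure Y \<subseteq> {p. norm (fst p) \<le> K * norm (fst p + snd p)}"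
    unfolding closure_Times[symmetric] by (rule closure_minimal[rotated])
  then show ?thesis unfolding positive_angle_def by fastforce
qed

text \<open>
  A positive angle makes addition on the complete space \<open>X \<times> Y\<close> bounded below, so its image is
  complete.
\<close>

lemma closed_set_plus:
  fixes X Y :: "'v::{real_normed_vector, complete_space} set"
  assumes "closed X" "closed Y" "subspace X" "subspace Y" "positive_angle X Y"
  shows "closed (X + Y)"
proof -
  obtain K where K: "\<And>x y. x \<in> X \<Longrightarrow> y \<in> Y \<Longrightarrow> norm x \<le> K * norm (x + y)"
    using assms unfolding positive_angle_def by blast
  have "complete ((\<lambda>p. fst p + snd p) ` (X \<times> Y))"
  proof (rule complete_isometric_image)
    show "0 < 1 / (2 * \<bar>K\<bar> + 1)" by (simp add: add_nonneg_pos)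
    show "subspace (X \<times> Y)" using assms by (intro subspace_Times)
    show "bounded_linear (\<lambda>p::'v \<times> 'v. fst p + snd p)"
      by (intro bounded_linear_add bounded_linear_fst bounded_linear_snd)
    show "complete (X \<times> Y)" using assms by (simp add: complete_eq_closed closed_Times)
    show "\<forall>p\<in>X \<times> Y. 1 / (2 * \<bar>K\<bar> + 1) * norm p \<le> norm (fst p + snd p)"
    proof clarify
      fix x y assume "x \<in> X" "y \<in> Y"
      have "norm (x, y) \<le> norm x + norm y" by (rule norm_Pair_le)
      also have "norm y \<le> norm (x + y) + norm x" using norm_triangle_ineq4[of "x + y" x] by simp
      also have "norm x \<le> \<bar>K\<bar> * norm (x + y)"
        using K[OF \<open>x \<in> X\<close> \<open>y \<in> Y\<close>] by (meson abs_ge_self mult_right_mono norm_ge_zero order_trans)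
      finally have "norm (x, y) \<le> (2 * \<bar>K\<bar> + 1) * norm (x + y)" by (simp add: algebra_simps)
      then show "1 / (2 * \<bar>K\<bar> + 1) * norm (x, y) \<le> norm (fst (x, y) + snd (x, y))"
        by (simp add: divide_le_eq add_nonneg_pos mult.commute)
    qed
  qed
  moreover have "(\<lambda>p. fst p + snd p) ` (X \<times> Y) = X + Y"
    by (force simp: mem_set_plus image_iff)
  ultimately show ?thesis by (simp add: complete_eq_closed)
qed

text \<open>
  A vector outside a closed subspace has positive distance from it, which is a positive angle
  between the line and the subspace.
\<close>

lemma closed_plus_line:
  fixes X :: "'v::{real_normed_vector, complete_space} set"
  assumes "closed X" "subspace X"
  shows "closed (X + span {v})"
proof (cases "v \<in> X")
  case True
  then have "span {v} \<subseteq> X" using assms by (simp add: span_minimal)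
  then have "X + span {v} = X"
    using assms by (simp add: set_plus_subspace_least subset_set_plus_left subset_antisym)
  then show ?thesis using assms by simp
next
  case False
  then have "v \<noteq> 0" using assms subspace_0 by blast
  obtain d where "d > 0" and d: "\<And>x. x \<in> X \<Longrightarrow> d \<le> dist v x"
    using infdist_pos_not_in_closed[OF \<open>closed X\<close> _ False] infdist_le[of _ X v] assms
    by (metis empty_iff subspace_0)
  have "complete ((\<lambda>k. k *\<^sub>R v) ` (UNIV :: real set))"
    using \<open>v \<noteq> 0\<close>
    by (intro complete_isometric_image[of "norm v"] bounded_linear_scaleR_left)
      (auto simp: complete_UNIV)
  then have "closed (span {v})" by (simp add: complete_eq_closed span_singleton)
  moreover have "positive_angle (span {v}) X"
    unfolding positive_angle_def
  proof (intro exI ballI)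
    fix u x assume "u \<in> span {v}" "x \<in> X"
    then obtain k where k: "u = k *\<^sub>R v" by (auto simp: span_singleton)
    show "norm u \<le> norm v / d * norm (u + x)"
    proof (cases "k = 0")
      case False
      have "d \<le> norm (v - (- 1 / k) *\<^sub>R x)"
        using d[of "(- 1 / k) *\<^sub>R x"] \<open>x \<in> X\<close> assms by (simp add: dist_norm subspace_scale del: scaleR_minus_left)
      then have "\<bar>k\<bar> * d \<le> norm (k *\<^sub>R (v - (- 1 / k) *\<^sub>R x))"
        by (simp add: mult_left_mono)
      also have "k *\<^sub>R (v - (- 1 / k) *\<^sub>R x) = u + x" using False k by (simp add: algebra_simps)
      finally have "norm v * (\<bar>k\<bar> * d) \<le> norm v * norm (u + x)" by (rule mult_left_mono) simp
      then show ?thesis using k \<open>d > 0\<close> by (simp add: field_simps)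
    qed (use k \<open>d > 0\<close> in simp)
  qed
  ultimately have "closed (span {v} + X)" using assms by (intro closed_set_plus) auto
  then show ?thesis by (simp add: add.commute)
qed

lemma closed_plus_finite:
  fixes X :: "'v::{real_normed_vector, complete_space} set"
  assumes "closed X" "subspace X" "finite B"
  shows "closed (X + span B)"
  using \<open>finite B\<close>
proof (induction B rule: finite_induct)
  case empty
  then show ?case using assms by simp
next
  case (insert v B)
  have "X + span (insert v B) = (X + span B) + span {v}"
    using span_Un_set_plus[of "{v}" B] by (simp add: ac_simps)
  then show ?case using insert assms by (simp add: closed_plus_line subspace_set_plus)
qed

lemma closed_almost_in:
  fixes D :: "'v::{real_normed_vector, complete_space} set"
  assumes "closed D" "subspace D" "subspace X" "D \<subseteq> X" "almost_in X D"
  shows "closed X"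
  using almost_complement[OF assms(2-5)] closed_plus_finite[OF assms(1,2)] by metis

text \<open>
  The closed core \<open>X \<inter> M + Y \<inter> N\<close> inherits the angle of \<open>M\<close> and \<open>N\<close>, and \<open>X + Y\<close> differs from it by
  finitely many dimensions only.
\<close>

lemma closed_set_plus_fd_congruent:
  fixes X Y :: "'v::{real_inner, complete_space} set"
  assumes "closed X" "closed Y" "subspace X" "subspace Y"
    and "closed M" "closed N" "subspace M" "subspace N"
    and "fd_congruent X M" "fd_congruent Y N" "positive_angle M N"
  shows "closed (X + Y)"
proof (rule closed_almost_in)
  let ?D = "X \<inter> M + Y \<inter> N"
  show "closed ?D"
    using assms
    by (intro closed_set_plus closed_Int subspace_inter positive_angle_subset[OF \<open>positive_angle M N\<close>]) auto
  show "subspace ?D" "subspace (X + Y)"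
    using assms by (simp_all add: subspace_set_plus subspace_inter)
  show "?D \<subseteq> X + Y" by (intro set_plus_mono2) auto
  have "almost_in X (X \<inter> M)" "almost_in Y (Y \<inter> N)"
    using almost_in_Int[of X X X M] almost_in_Int[of Y Y Y N] assms
    by (simp_all add: fd_congruent_iff almost_in_subset)
  then show "almost_in (X + Y) ?D" by (rule almost_in_plus)
qed

text \<open>
  An almost complement can be corrected to a complement: remove from \<open>N\<close> the finite-dimensional
  overlap with \<open>X\<close>, then add finitely many missing directions. Taking the orthogonal complement of
  the overlap inside \<open>N\<close> keeps \<open>N\<close> closed.
\<close>

lemma exists_closed_complement:
  fixes X N :: "'v::{real_inner, complete_space} set"
  assumes "subspace X" "closed N" "subspace N"
    and "fd_congruent (X \<inter> N) {0}" "fd_congruent (X + N) UNIV"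
  obtains Y where "closed Y" "subspace Y" "fd_congruent Y N" "X \<inter> Y = {0}" "X + Y = UNIV"
proof -
  have XN: "subspace (X \<inter> N)" using assms by (simp add: subspace_inter)
  have "almost_in (X \<inter> N) {0}" using assms XN by (simp add: fd_congruent_iff)
  then obtain F0 where "finite F0" "span F0 = X \<inter> N"
    using almost_complement[of "{0}" "X \<inter> N"] XN
    by (metis add.left_neutral empty_subsetI insert_subset set_zero subspace_0 subspace_single_0)
  then obtain F where F: "finite F" "span F = X \<inter> N" "pairwise orthogonal F"
    using basis_orthogonal by metis
  define N1 where "N1 = N \<inter> {w. \<forall>b\<in>F. orthogonal b w}"
  have N1: "closed N1" "subspace N1"
  proof -
    have "{w. \<forall>b\<in>F. orthogonal b w} = (\<Inter>b\<in>F. {w. b \<bullet> w = 0})"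
      by (auto simp: orthogonal_def)
    then show "closed N1" unfolding N1_def using assms by (auto intro!: closed_Int closed_INT closed_hyperplane)
    show "subspace N1" unfolding N1_def using assms by (intro subspace_inter subspace_orthogonal_to_vectors)
  qed
  have FN: "F \<subseteq> N" using F(2) span_superset by blast
  have "N1 + span F = N"
  proof
    show "N1 + span F \<subseteq> N"
      using F(2) assms unfolding N1_def by (intro set_plus_subspace_least) auto
    show "N \<subseteq> N1 + span F"
    proof
      fix w assume "w \<in> N"
      \<comment> \<open>The orthogonal projection of \<open>w\<close> to the span of the orthogonal set \<open>F\<close>.\<close>
      define p where "p = (\<Sum>b\<in>F. (b \<bullet> w / (b \<bullet> b)) *\<^sub>R b)"
      have p: "p \<in> span F" unfolding p_def by (intro span_sum span_scale span_base)
      have "orthogonal b (w - p)" if "b \<in> F" for b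
      proof -
        have "b \<bullet> p = (\<Sum>c\<in>F. if c = b then b \<bullet> w else 0)"
          unfolding p_def inner_sum_right
          using F(3) that by (intro sum.cong) (auto simp: pairwise_def orthogonal_def)
        also have "\<dots> = b \<bullet> w" using that F(1) by simp
        finally show ?thesis by (simp add: orthogonal_def inner_diff_right)
      qed
      moreover have "w - p \<in> N" using \<open>w \<in> N\<close> p F(2) assms by (intro subspace_diff) auto
      ultimately have "w - p \<in> N1" unfolding N1_def by blast
      then have "(w - p) + p \<in> N1 + span F" using p by (rule set_plus_intro)
      then show "w \<in> N1 + span F" by simp
    qed
  qed
  have XN1: "X \<inter> N1 = {0}"
  proof -
    have "w = 0" if "w \<in> X" "w \<in> N1" for w
    proof -
      have "w \<in> span F" using that F(2) unfolding N1_def by blast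
      moreover have "span F \<subseteq> {u. orthogonal w u}"
        using that unfolding N1_def
        by (intro span_minimal subspace_orthogonal_to_vector) (auto simp: orthogonal_commute)
      ultimately show "w = 0" by (auto simp: orthogonal_self)
    qed
    then show ?thesis using assms N1 by (auto simp: subspace_0)
  qed
  have fdN: "fd_congruent N1 N"
    using fd_congruent_sym[OF fd_congruent_plus_finite[OF F(1), of N1]] \<open>N1 + span F = N\<close> by simp
  have "fd_congruent (X + N1) (X + N)" by (rule fd_congruent_plus[OF fd_congruent_refl fdN])
  then have "fd_congruent (X + N1) UNIV" using assms(5) by (rule fd_congruent_trans)
  then have "almost_in UNIV (X + N1)"
    using assms N1 by (simp add: fd_congruent_iff subspace_set_plus)
  then obtain C where C: "finite C" "span C \<inter> (X + N1) = {0}" "X + N1 + span C = UNIV"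
    using almost_complement[OF subspace_set_plus[OF assms(1) N1(2)] subspace_UNIV subset_UNIV] by metis
  show thesis
  proof (rule that)
    show "closed (N1 + span C)" using N1 C by (intro closed_plus_finite)
    show "subspace (N1 + span C)" using N1 by (simp add: subspace_set_plus)
    show "fd_congruent (N1 + span C) N" by (rule fd_congruent_trans[OF fd_congruent_plus_finite[OF C(1)] fdN])
    show "X + (N1 + span C) = UNIV" using C(3) by (simp add: add.assoc)
    have "w = 0" if w: "w \<in> X" "w \<in> N1 + span C" for w
    proof -
      obtain n c where nc: "n \<in> N1" "c \<in> span C" "w = n + c" using w(2) by (blast elim: set_plus_elim)
      have "w + (- n) \<in> X + N1" using w(1) nc N1 by (intro set_plus_intro) (auto simp: subspace_neg)
      then have "c \<in> span C \<inter> (X + N1)" using nc by simp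
      then have "c = 0" using C(2) by blast
      then show ?thesis using nc w XN1 by auto
    qed
    then show "X \<inter> (N1 + span C) = {0}"
      using assms N1 by (auto simp: subspace_0 subspace_set_plus)
  qed
qed

section \<open>The lattice generated by a pairwise transversal family\<close>

lemma fd_saturation_simps [simp]:
  "lmeet (fd_saturation M) = (\<inter>)"
  "ljoin (fd_saturation M) = (\<lambda>x y. closure (x + y))"
  "lzero (fd_saturation M) = {0}"
  "x \<in> carrier (fd_saturation M) \<longleftrightarrow> subspace x \<and> closed x \<and> (\<exists>m\<in>M. fd_congruent x m)"
  by (auto simp: fd_saturation_def closed_subspace_lattice_def)

lemma fd_saturation_cong:
  assumes "\<And>m. m \<in> M \<Longrightarrow> \<exists>n\<in>N. fd_congruent m n" "\<And>n. n \<in> N \<Longrightarrow> \<exists>m\<in>M. fd_congruent n m"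
  shows "fd_saturation M = fd_saturation N"
proof -
  have "(\<exists>m\<in>M. fd_congruent x m) \<longleftrightarrow> (\<exists>n\<in>N. fd_congruent x n)" for x
    using assms by (meson fd_congruent_trans)
  then show ?thesis unfolding fd_saturation_def by simp
qed

lemma perspectiveI_common_complement:
  assumes "t \<in> carrier (fd_saturation M)" "x \<inter> t = {0}" "y \<inter> t = {0}" "x + t = UNIV" "y + t = UNIV"
  shows "perspective (fd_saturation M) x y"
  unfolding perspective_def using assms(2-5) by (intro bexI[OF _ assms(1)]) simp

text \<open>
  Two transversal subspaces are complementary modulo finite-dimensional subspaces, with the bound
  that keeps sums closed.
\<close>

definition transversal :: "'v::real_inner set \<Rightarrow> 'v set \<Rightarrow> bool" where
  "transversal X Y \<longleftrightarrow> positive_angle X Y \<and> fd_congruent (X + Y) UNIV"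

lemma transversal_Int: "transversal X Y \<Longrightarrow> subspace X \<Longrightarrow> subspace Y \<Longrightarrow> X \<inter> Y = {0}"
  unfolding transversal_def by (simp add: positive_angle_Int)

lemma transversal_sym: "transversal X Y \<Longrightarrow> transversal Y X"
  by (simp add: transversal_def positive_angle_sym add.commute)

text \<open>
  If the models \<open>m\<close> and \<open>n\<close> are comparable, they have no positive angle in general, but then the sum
  exceeds its closed larger summand by finitely many dimensions only.
\<close>

lemma closed_set_plus_fd_congruent_subset:
  fixes x y :: "'v::{real_inner, complete_space} set"
  assumes "fd_congruent x m" "fd_congruent y n" "n \<subseteq> m"
    and "subspace x" "closed x" "subspace y" "subspace m" "subspace n"
  shows "closed (x + y)"
proof (rule closed_almost_in)
  have "m + n = m"
    using assms by (simp add: set_plus_subspace_least subset_set_plus_left subset_antisym)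
  then have "fd_congruent (x + y) x"
    using fd_congruent_plus[OF assms(1,2)] fd_congruent_trans fd_congruent_sym[OF assms(1)] by auto
  then show "almost_in (x + y) x" using assms by (simp add: fd_congruent_iff subspace_set_plus)
qed (use assms in \<open>simp_all add: subspace_set_plus subset_set_plus_left\<close>)

text \<open>
  Modulo finite-dimensional subspaces the members of \<open>\<F>\<close> together with \<open>0\<close> and the whole space form
  a lattice of height at most two; the last assumption gives each atom a complement.
\<close>

locale transversal_family =
  fixes \<F> :: "'v::{real_inner, complete_space} set set"
  assumes member: "m \<in> \<F> \<Longrightarrow> subspace m \<and> closed m"
    and transversal: "m \<in> \<F> \<Longrightarrow> n \<in> \<F> \<Longrightarrow> m \<noteq> n \<Longrightarrow> transversal m n"
    and partner: "m \<in> \<F> \<Longrightarrow> \<exists>n\<in>\<F>. n \<noteq> m"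
begin

abbreviation "saturation \<equiv> fd_saturation (insert {0} (insert UNIV \<F>))"

lemma Int_carrier:
  assumes x: "x \<in> carrier saturation" and y: "y \<in> carrier saturation"
  shows "x \<inter> y \<in> carrier saturation"
proof -
  obtain m where m: "m \<in> insert {0} (insert UNIV \<F>)" "fd_congruent x m" using x by auto
  obtain n where n: "n \<in> insert {0} (insert UNIV \<F>)" "fd_congruent y n" using y by auto
  have sub: "subspace m" "subspace n" using m n member by auto
  have "m \<inter> n \<in> insert {0} (insert UNIV \<F>)"
  proof (cases "m \<in> \<F> \<and> n \<in> \<F> \<and> m \<noteq> n")
    case True
    then have "m \<inter> n = {0}"
      using transversal[of m n] sub unfolding transversal_def by (simp add: positive_angle_Int)
    then show ?thesis by simp
  next
    case False
    then show ?thesis using m n sub subspace_0 by (auto simp: Int_absorb)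
  qed
  moreover have "fd_congruent (x \<inter> y) (m \<inter> n)"
    using m n sub x y by (intro fd_congruent_Int) auto
  ultimately show ?thesis using x y by (auto simp: subspace_inter closed_Int)
qed

lemma closed_plus_carrier:
  assumes x: "x \<in> carrier saturation" and y: "y \<in> carrier saturation"
  shows "closed (x + y)"
proof -
  obtain m where m: "m \<in> insert {0} (insert UNIV \<F>)" "fd_congruent x m" using x by auto
  obtain n where n: "n \<in> insert {0} (insert UNIV \<F>)" "fd_congruent y n" using y by auto
  have mn: "subspace m" "subspace n" "closed m" "closed n" using m n member by auto
  have xy: "subspace x" "subspace y" "closed x" "closed y" using x y by auto
  consider "m \<in> \<F>" "n \<in> \<F>" "m \<noteq> n" | "n \<subseteq> m" | "m \<subseteq> n"
    using m n mn subspace_0 by fastforce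
  then show ?thesis
  proof cases
    case 1
    then have "positive_angle m n" using transversal unfolding transversal_def by blast
    then show ?thesis using m n mn xy by (intro closed_set_plus_fd_congruent[of x y m n]) auto
  next
    case 2
    then show ?thesis
      using m n mn xy by (intro closed_set_plus_fd_congruent_subset[of x m y n]) auto
  next
    case 3
    then have "closed (y + x)"
      using m n mn xy by (intro closed_set_plus_fd_congruent_subset[of y n x m]) auto
    then show ?thesis by (simp add: add.commute)
  qed
qed

lemma plus_carrier:
  assumes x: "x \<in> carrier saturation" and y: "y \<in> carrier saturation"
  shows "x + y \<in> carrier saturation"
proof -
  obtain m where m: "m \<in> insert {0} (insert UNIV \<F>)" "fd_congruent x m" using x by auto
  obtain n where n: "n \<in> insert {0} (insert UNIV \<F>)" "fd_congruent y n" using y by auto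
  have sub: "subspace m" "subspace n" using m n member by auto
  have xy: "subspace (x + y)" "closed (x + y)"
    using x y closed_plus_carrier by (auto simp: subspace_set_plus)
  have fd: "fd_congruent (x + y) (m + n)" using m n by (intro fd_congruent_plus)
  consider "m \<in> \<F>" "n \<in> \<F>" "m \<noteq> n" | "n \<subseteq> m" | "m \<subseteq> n"
    using m n sub subspace_0 by fastforce
  then have "\<exists>k\<in>insert {0} (insert UNIV \<F>). fd_congruent (m + n) k"
  proof cases
    case 1
    then show ?thesis using transversal unfolding transversal_def by blast
  next
    case 2
    then have "m + n = m"
      using sub by (simp add: set_plus_subspace_least subset_set_plus_left subset_antisym)
    then show ?thesis using m(1) fd_congruent_refl by metis
  next
    case 3
    then have "m + n = n"
      using sub by (simp add: set_plus_subspace_least subset_set_plus_right subset_antisym)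
    then show ?thesis using n(1) fd_congruent_refl by metis
  qed
  then obtain k where k: "k \<in> insert {0} (insert UNIV \<F>)" "fd_congruent (m + n) k" by (rule bexE)
  from fd k(2) have "fd_congruent (x + y) k" by (rule fd_congruent_trans)
  then show ?thesis unfolding fd_saturation_simps(4) using xy k(1) by (intro conjI bexI[of _ k])
qed

lemma exists_complement_carrier:
  assumes x: "x \<in> carrier saturation"
  shows "\<exists>y\<in>carrier saturation. x \<inter> y = {0} \<and> x + y = UNIV"
proof -
  obtain m where m: "m \<in> insert {0} (insert UNIV \<F>)" "fd_congruent x m" using x by auto
  have sub: "subspace x" "subspace m" using m x member by auto
  have "\<exists>n\<in>insert {0} (insert UNIV \<F>). subspace n \<and> closed n \<and> m \<inter> n = {0} \<and> fd_congruent (m + n) UNIV"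
  proof -
    consider "m = {0}" | "m = UNIV" | "m \<in> \<F>" using m by auto
    then show ?thesis
    proof cases
      case 1
      then show ?thesis by (auto intro!: bexI[of _ UNIV] fd_congruent_refl simp: mem_set_plus)
    next
      case 2
      then show ?thesis by (auto intro!: bexI[of _ "{0}"] fd_congruent_refl simp: mem_set_plus)
    next
      case 3
      then obtain n where n: "n \<in> \<F>" "n \<noteq> m" using partner by blast
      then have "positive_angle m n" "fd_congruent (m + n) UNIV"
        using transversal[of m n] 3 unfolding transversal_def by auto
      moreover have "m \<inter> n = {0}" using calculation(1) n 3 member by (simp add: positive_angle_Int)
      ultimately show ?thesis using n member[of n] by blast
    qed
  qed
  then obtain n where n: "n \<in> insert {0} (insert UNIV \<F>)" "subspace n" "closed n" "m \<inter> n = {0}"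
    "fd_congruent (m + n) UNIV" by (elim bexE conjE) (rule that)
  have "fd_congruent (x \<inter> n) {0}"
    using fd_congruent_Int[OF m(2) fd_congruent_refl sub(1) n(2) sub(2) n(2)] n(4) by simp
  moreover have "fd_congruent (x + n) UNIV"
    using fd_congruent_trans[OF fd_congruent_plus[OF m(2) fd_congruent_refl] n(5)] .
  ultimately obtain y where y: "closed y" "subspace y" "fd_congruent y n" "x \<inter> y = {0}" "x + y = UNIV"
    by (rule exists_closed_complement[OF sub(1) n(3) n(2)])
  have "y \<in> carrier saturation"
    unfolding fd_saturation_simps(4) using y(1-3) n(1) by (intro conjI bexI[of _ n])
  then show ?thesis using y(4,5) by (intro bexI[of _ y] conjI)
qed

lemma ljoin_carrier:
  "x \<in> carrier saturation \<Longrightarrow> y \<in> carrier saturation \<Longrightarrow>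
    ljoin saturation x y = x + y"
  unfolding fd_saturation_simps(2) by (intro closure_closed closed_plus_carrier)

lemma complemented_modular_saturation: "complemented_modular_lattice saturation"
proof -
  note [simp] = ljoin_carrier and [simp del] = fd_saturation_simps(2,4)
  have sub: "subspace x" if "x \<in> carrier saturation" for x
    using that fd_saturation_simps(4) by blast
  have zero_carrier: "{0} \<in> carrier saturation"
    by (auto simp: fd_saturation_simps(4) intro: fd_congruent_refl)
  show ?thesis
  proof
    fix x y z
    assume x: "x \<in> carrier saturation"
    show "ljoin saturation x (lzero saturation) = x"
      unfolding fd_saturation_simps(3) ljoin_carrier[OF x zero_carrier] by (simp flip: set_zero)
    assume y: "y \<in> carrier saturation"
    show "lmeet saturation x y \<in> carrier saturation" using Int_carrier[OF x y] by simp
    show "ljoin saturation x y \<in> carrier saturation" using x y plus_carrier[OF x y] by simp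
    show "lmeet saturation x y = lmeet saturation y x" by (simp add: Int_commute)
    show "ljoin saturation x y = ljoin saturation y x" using x y by (simp add: add.commute)
    show "lmeet saturation x (ljoin saturation x y) = x"
      using x y by (simp add: Int_absorb2 subset_set_plus_left sub)
    show "ljoin saturation x (lmeet saturation x y) = x"
      using x y Int_carrier[OF x y]
      by (simp add: set_plus_subspace_least subset_set_plus_left subset_antisym sub)
    assume z: "z \<in> carrier saturation"
    show "lmeet saturation (lmeet saturation x y) z = lmeet saturation x (lmeet saturation y z)"
      by (simp add: Int_assoc)
    show "ljoin saturation (ljoin saturation x y) z = ljoin saturation x (ljoin saturation y z)"
      using x y z plus_carrier[OF x y] plus_carrier[OF y z] by (simp add: add.assoc)
    assume "lmeet saturation x z = x"
    then have xz: "x \<subseteq> z" by auto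
    have "x + y \<inter> z = (x + y) \<inter> z"
    proof
      show "x + y \<inter> z \<subseteq> (x + y) \<inter> z"
        using set_plus_subspace_least[OF sub[OF z] xz, of "y \<inter> z"] set_plus_mono2[of x x "y \<inter> z" y] by blast
      show "(x + y) \<inter> z \<subseteq> x + y \<inter> z"
      proof clarify
        fix w assume "w \<in> x + y" "w \<in> z"
        then obtain u v where uv: "u \<in> x" "v \<in> y" "w = u + v" by (blast elim: set_plus_elim)
        then have "v = w - u" by simp
        then have "v \<in> z" using \<open>w \<in> z\<close> uv xz sub[OF z] by (metis subsetD subspace_diff)
        then show "w \<in> x + y \<inter> z" using uv by blast
      qed
    qed
    then show "ljoin saturation x (lmeet saturation y z) = lmeet saturation (ljoin saturation x y) z"
      using x y z Int_carrier[OF y z] by simp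
  next
    show "lzero saturation \<in> carrier saturation" using zero_carrier by simp
    have U: "UNIV \<in> carrier saturation"
      by (auto simp: fd_saturation_simps(4) intro: fd_congruent_refl)
    have "\<exists>y\<in>carrier saturation. lmeet saturation x y = lzero saturation \<and>
        ljoin saturation x y = UNIV" if "x \<in> carrier saturation" for x
      using exists_complement_carrier[OF that] ljoin_carrier[OF that]
      unfolding fd_saturation_simps(1,3) by metis
    then show "\<exists>u\<in>carrier saturation. \<forall>x\<in>carrier saturation. lmeet saturation x u = x \<and>
        (\<exists>y\<in>carrier saturation. lmeet saturation x y = lzero saturation \<and>
          ljoin saturation x y = u)"
      using U by (intro bexI[of _ UNIV]) auto
  qed
qed

end

section \<open>Closed spans and orthogonality\<close>

lemma subspace_closure:
  fixes S :: "'v::real_normed_vector set"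
  assumes "subspace S"
  shows "subspace (closure S)"
proof (rule subspaceI)
  show "0 \<in> closure S" using assms closure_subset subspace_0 by blast
  show "x + y \<in> closure S" if "x \<in> closure S" "y \<in> closure S" for x y
    using closure_sum[of S S] set_plus_intro[OF that] subspace_set_plus_self[OF assms] by auto
  show "c *\<^sub>R x \<in> closure S" if "x \<in> closure S" for c x
  proof -
    have "(*\<^sub>R) c ` S \<subseteq> S" using assms by (auto intro: subspace_scale)
    then have "(*\<^sub>R) c ` closure S \<subseteq> closure S"
      unfolding closure_scaleR by (rule closure_mono)
    then show ?thesis using that by blast
  qed
qed

lemma subspace_closed_span [simp]: "subspace (closed_span X)"
  by (simp add: closed_span_def subspace_closure)

lemma closed_closed_span [simp]: "closed (closed_span X)"
  by (simp add: closed_span_def)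

lemma subset_closed_span: "X \<subseteq> closed_span X"
  unfolding closed_span_def using span_superset closure_subset by (rule order_trans)

lemma closed_span_minimal: "X \<subseteq> Z \<Longrightarrow> subspace Z \<Longrightarrow> closed Z \<Longrightarrow> closed_span X \<subseteq> Z"
  unfolding closed_span_def by (simp add: closure_minimal span_minimal)

lemma orthogonal_closed_span:
  assumes "\<And>s t. s \<in> S \<Longrightarrow> t \<in> T \<Longrightarrow> s \<bullet> t = 0" and "u \<in> closed_span S" "v \<in> closed_span T"
  shows "u \<bullet> v = 0"
proof -
  have *: "closed_span T \<subseteq> {v. s \<bullet> v = 0}" if "\<And>t. t \<in> T \<Longrightarrow> s \<bullet> t = 0" for s :: 'a and T
    using that by (intro closed_span_minimal) (auto simp: subspace_hyperplane closed_hyperplane)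
  have "closed_span S \<subseteq> {u. v \<bullet> u = 0}"
    using * assms(1,3) by (intro *) (auto simp: inner_commute[of v])
  then show ?thesis using assms(2) by (auto simp: inner_commute)
qed

lemma positive_angle_orthogonal:
  fixes X Y :: "'v::real_inner set"
  assumes "\<And>x y. x \<in> X \<Longrightarrow> y \<in> Y \<Longrightarrow> x \<bullet> y = 0"
  shows "positive_angle X Y"
  unfolding positive_angle_def
proof (intro exI[of _ 1] ballI)
  fix x y assume "x \<in> X" "y \<in> Y"
  then have "(norm (x + y))\<^sup>2 = (norm x)\<^sup>2 + (norm y)\<^sup>2"
    using assms by (intro norm_add_Pythagorean) (simp add: orthogonal_def)
  then have "(norm x)\<^sup>2 \<le> (norm (x + y))\<^sup>2" by simp
  then show "norm x \<le> 1 * norm (x + y)" by (simp add: power2_le_iff_abs_le)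
qed

text \<open>
  Splitting a vector orthogonal to \<open>X\<close> along \<open>X + Y\<close> kills its \<open>X\<close>-component. In this way
  orthogonal complements are found from explicit decompositions of the space.
\<close>

lemma orthogonal_comp_eq:
  assumes "subspace Y" "\<And>x y. x \<in> X \<Longrightarrow> y \<in> Y \<Longrightarrow> x \<bullet> y = 0" "X + Y = UNIV"
  shows "X\<^sup>\<bottom> = Y"
proof
  show "Y \<subseteq> X\<^sup>\<bottom>" using assms(2) by (auto simp: orthogonal_comp_def orthogonal_def)
  show "X\<^sup>\<bottom> \<subseteq> Y"
  proof
    fix w assume w: "w \<in> X\<^sup>\<bottom>"
    obtain x y where xy: "x \<in> X" "y \<in> Y" "w = x + y"
      using assms(3) by (metis UNIV_I set_plus_elim)
    then have "x \<bullet> x = x \<bullet> w" using assms(2) by (simp add: inner_add_right)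
    also have "\<dots> = 0" using w xy(1) by (simp add: orthogonal_comp_def orthogonal_def)
    finally show "w \<in> Y" using xy by simp
  qed
qed

lemma span_range_sum:
  assumes "u \<in> span (range g)"
  obtains I c where "finite I" "u = (\<Sum>i\<in>I. c i *\<^sub>R g i)"
proof -
  obtain t r where t: "finite t" "t \<subseteq> range g" "u = (\<Sum>a\<in>t. r a *\<^sub>R a)"
    using assms unfolding span_explicit by blast
  obtain I where I: "inj_on g I" "t = g ` I" using t(2) unfolding subset_image_inj by blast
  have "u = (\<Sum>i\<in>I. r (g i) *\<^sub>R g i)" using t(3) I by (simp add: sum.reindex)
  moreover have "finite I" using I t(1) by (simp add: finite_image_iff)
  ultimately show ?thesis using that[of I "\<lambda>i. r (g i)"] by simp
qed

text \<open>
  Infinitely many nonzero orthogonal vectors do not fit into a finite-dimensional subspace.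
\<close>

lemma not_almost_in_zero:
  fixes g :: "nat \<Rightarrow> 'v::real_inner"
  assumes "\<And>i j. i \<noteq> j \<Longrightarrow> g i \<bullet> g j = 0" "\<And>i. g i \<noteq> 0" "range g \<subseteq> X"
  shows "\<not> almost_in X {0}"
proof
  assume "almost_in X {0}"
  then obtain B where B: "finite B" "X \<subseteq> {0} + span B" unfolding almost_in_def by blast
  then have "range g \<subseteq> span B" using assms(3) by simp
  moreover have "independent (range g)"
  proof (rule pairwise_orthogonal_independent)
    have "g i \<bullet> g j = 0" if "g i \<noteq> g j" for i j using assms(1)[of i j] that by auto
    then show "pairwise orthogonal (range g)" by (auto simp: pairwise_def orthogonal_def)
    show "0 \<notin> range g" using assms(2) by (metis rangeE)
  qed
  ultimately have "finite (range g)" using independent_span_bound[OF B(1)] by blast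
  moreover have "inj g"
    using assms(1,2) by (metis injI inner_eq_zero_iff)
  ultimately show False by (simp add: finite_image_iff)
qed

section \<open>Slanted subspaces\<close>

locale paired_orthonormal_basis =
  fixes e f :: "nat \<Rightarrow> 'h::{real_inner, complete_space}"
  assumes orthonormal_basis: "orthonormal_basis (case_sum e f)"
begin

lemma inner_basis [simp]:
  "e i \<bullet> e j = (if i = j then 1 else 0)" "f i \<bullet> f j = (if i = j then 1 else 0)"
  "e i \<bullet> f j = 0" "f i \<bullet> e j = 0"
proof -
  have *: "case_sum e f p \<bullet> case_sum e f q = (if p = q then 1 else 0)" for p q
    using orthonormal_basis unfolding orthonormal_basis_def by blast
  show "e i \<bullet> e j = (if i = j then 1 else 0)" "f i \<bullet> f j = (if i = j then 1 else 0)"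
    "e i \<bullet> f j = 0" "f i \<bullet> e j = 0"
    using *[of "Inl i" "Inl j"] *[of "Inr i" "Inr j"] *[of "Inl i" "Inr j"] *[of "Inr i" "Inl j"]
    by simp_all
qed

text \<open>
  The only way in which completeness of the basis enters: a closed subspace is everything once it
  contains the basis vectors.
\<close>

lemma basis_dense:
  assumes "subspace Z" "closed Z" "\<And>i. e i \<in> Z" "\<And>i. f i \<in> Z"
  shows "Z = UNIV"
proof -
  have "range (case_sum e f) \<subseteq> Z" using assms(3,4) by (auto split: sum.splits)
  then have "closed_span (range (case_sum e f)) \<subseteq> Z" using assms by (simp add: closed_span_minimal)
  then show ?thesis
    using orthonormal_basis unfolding orthonormal_basis_def closed_span_def by auto
qed

text \<open>
  For injective \<open>\<sigma>\<close> this is the graph-like subspace \<open>{\<alpha> x + \<beta> T x}\<close>, where \<open>x\<close> ranges over the closed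
  span of the \<open>e\<^sub>i\<close> and \<open>T\<close> is the isometry sending \<open>e\<^sub>i\<close> to \<open>f\<^sub>\<sigma>\<^sub>(\<^sub>i\<^sub>)\<close>.
\<close>

definition slanted :: "real \<Rightarrow> real \<Rightarrow> (nat \<Rightarrow> nat) \<Rightarrow> 'h set" where
  "slanted \<alpha> \<beta> \<sigma> = closed_span (range (\<lambda>i. \<alpha> *\<^sub>R e i + \<beta> *\<^sub>R f (\<sigma> i)))"

lemma subspace_slanted [simp]: "subspace (slanted \<alpha> \<beta> \<sigma>)"
  and closed_slanted [simp]: "closed (slanted \<alpha> \<beta> \<sigma>)"
  by (simp_all add: slanted_def)

lemma slanted_generator: "\<alpha> *\<^sub>R e i + \<beta> *\<^sub>R f (\<sigma> i) \<in> slanted \<alpha> \<beta> \<sigma>"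
  unfolding slanted_def by (rule subsetD[OF subset_closed_span rangeI])

text \<open>
  The two components carry the same coefficients with respect to orthonormal systems, hence
  have equal norms.
\<close>

lemma span_slanted:
  assumes "u \<in> span (range (\<lambda>i. \<alpha> *\<^sub>R e i + \<beta> *\<^sub>R f (\<sigma> i)))" "inj \<sigma>"
  obtains x y where "x \<in> span (range e)" "y \<in> span (range f)" "norm x = norm y"
    "u = \<alpha> *\<^sub>R x + \<beta> *\<^sub>R y"
proof -
  obtain I c where I: "finite I" "u = (\<Sum>i\<in>I. c i *\<^sub>R (\<alpha> *\<^sub>R e i + \<beta> *\<^sub>R f (\<sigma> i)))"
    using span_range_sum[OF assms(1)] by metis
  define x where "x = (\<Sum>i\<in>I. c i *\<^sub>R e i)"
  define y where "y = (\<Sum>i\<in>I. c i *\<^sub>R f (\<sigma> i))"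
  have "u = \<alpha> *\<^sub>R x + \<beta> *\<^sub>R y"
    unfolding I(2) x_def y_def by (simp add: scaleR_sum_right sum.distrib algebra_simps)
  moreover have "x \<in> span (range e)" "y \<in> span (range f)"
    unfolding x_def y_def by (intro span_sum span_scale span_base; simp)+
  moreover have "norm x = norm y"
  proof -
    have "(norm x)\<^sup>2 = (\<Sum>i\<in>I. (norm (c i *\<^sub>R e i))\<^sup>2)"
      unfolding x_def using I(1) by (intro norm_sum_Pythagorean) (auto simp: pairwise_def orthogonal_def)
    also have "\<dots> = (\<Sum>i\<in>I. (norm (c i *\<^sub>R f (\<sigma> i)))\<^sup>2)"
      by (simp add: norm_eq_sqrt_inner)
    also have "\<dots> = (norm y)\<^sup>2"
      unfolding y_def using I(1) assms(2)
      by (intro norm_sum_Pythagorean[symmetric]) (auto simp: pairwise_def orthogonal_def inj_eq)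
    finally show ?thesis by (simp add: power2_eq_iff_nonneg)
  qed
  ultimately show ?thesis by (intro that[of x y])
qed

lemma norm_components_le:
  assumes "x \<in> span (range e)" "y \<in> span (range f)"
  shows "norm x \<le> norm (x + y)" "norm y \<le> norm (x + y)"
proof -
  have "x \<bullet> y = 0"
  proof (rule orthogonal_closed_span[of "range e" "range f"])
    show "x \<in> closed_span (range e)" "y \<in> closed_span (range f)"
      using assms by (simp_all add: closed_span_def subsetD[OF closure_subset])
  qed auto
  then have "(norm (x + y))\<^sup>2 = (norm x)\<^sup>2 + (norm y)\<^sup>2"
    by (intro norm_add_Pythagorean) (simp add: orthogonal_def)
  then have "(norm x)\<^sup>2 \<le> (norm (x + y))\<^sup>2" "(norm y)\<^sup>2 \<le> (norm (x + y))\<^sup>2" by simp_all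
  then show "norm x \<le> norm (x + y)" "norm y \<le> norm (x + y)" by (simp_all add: power2_le_iff_abs_le)
qed

text \<open>
  Let \<open>u = \<alpha> x + \<beta> y\<close> and \<open>v = \<alpha>' x' + \<beta>' y'\<close> with \<open>x\<close>, \<open>y\<close> of norm \<open>s\<close> and \<open>x'\<close>, \<open>y'\<close> of norm
  \<open>s'\<close>. Comparing components, \<open>\<bar>\<alpha>\<bar> s - \<bar>\<alpha>'\<bar> s'\<close> and \<open>\<bar>\<beta>\<bar> s - \<bar>\<beta>'\<bar> s'\<close> are both bounded by the norm of
  \<open>u + v\<close>. When the absolute slopes differ, Cramer's rule solves these for \<open>s\<close>.
\<close>

lemma positive_angle_slanted:
  assumes "\<bar>\<alpha> * \<beta>'\<bar> \<noteq> \<bar>\<alpha>' * \<beta>\<bar>" "inj \<sigma>" "inj \<sigma>'"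
  shows "positive_angle (slanted \<alpha> \<beta> \<sigma>) (slanted \<alpha>' \<beta>' \<sigma>')"
  unfolding slanted_def closed_span_def
proof (rule positive_angle_closure, unfold positive_angle_def, intro exI ballI)
  let ?\<Delta> = "\<bar>\<bar>\<alpha> * \<beta>'\<bar> - \<bar>\<alpha>' * \<beta>\<bar>\<bar>"
  fix u v
  assume *: "u \<in> span (range (\<lambda>i. \<alpha> *\<^sub>R e i + \<beta> *\<^sub>R f (\<sigma> i)))"
    "v \<in> span (range (\<lambda>i. \<alpha>' *\<^sub>R e i + \<beta>' *\<^sub>R f (\<sigma>' i)))"
  obtain x y where x: "x \<in> span (range e)" and y: "y \<in> span (range f)"
    and n: "norm x = norm y" and u: "u = \<alpha> *\<^sub>R x + \<beta> *\<^sub>R y"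
    by (rule span_slanted[OF *(1) assms(2)])
  obtain x' y' where x': "x' \<in> span (range e)" and y': "y' \<in> span (range f)"
    and n': "norm x' = norm y'" and v: "v = \<alpha>' *\<^sub>R x' + \<beta>' *\<^sub>R y'"
    by (rule span_slanted[OF *(2) assms(3)])
  define w where "w = norm (u + v)"
  have uv: "u + v = (\<alpha> *\<^sub>R x + \<alpha>' *\<^sub>R x') + (\<beta> *\<^sub>R y + \<beta>' *\<^sub>R y')"
    using u v by (simp add: algebra_simps)
  have "norm (\<alpha> *\<^sub>R x + \<alpha>' *\<^sub>R x') \<le> w" "norm (\<beta> *\<^sub>R y + \<beta>' *\<^sub>R y') \<le> w"
    unfolding w_def uv by (intro norm_components_le span_add span_scale x y x' y')+
  moreover have "\<bar>norm p - norm q\<bar> \<le> norm (p + q)" for p q :: 'h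
    using norm_triangle_ineq3[of p "- q"] by simp
  ultimately have le: "\<bar>\<bar>\<alpha>\<bar> * norm x - \<bar>\<alpha>'\<bar> * norm x'\<bar> \<le> w" "\<bar>\<bar>\<beta>\<bar> * norm x - \<bar>\<beta>'\<bar> * norm x'\<bar> \<le> w"
    by (metis norm_scaleR n n' order_trans)+
  have "?\<Delta> * norm x = \<bar>\<bar>\<beta>'\<bar> * (\<bar>\<alpha>\<bar> * norm x - \<bar>\<alpha>'\<bar> * norm x') - \<bar>\<alpha>'\<bar> * (\<bar>\<beta>\<bar> * norm x - \<bar>\<beta>'\<bar> * norm x')\<bar>"
  proof -
    have "\<bar>\<beta>'\<bar> * (\<bar>\<alpha>\<bar> * norm x - \<bar>\<alpha>'\<bar> * norm x') - \<bar>\<alpha>'\<bar> * (\<bar>\<beta>\<bar> * norm x - \<bar>\<beta>'\<bar> * norm x')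
        = (\<bar>\<alpha> * \<beta>'\<bar> - \<bar>\<alpha>' * \<beta>\<bar>) * norm x"
      by (simp add: abs_mult algebra_simps)
    then show ?thesis by (simp add: abs_mult)
  qed
  also have "\<dots> \<le> \<bar>\<beta>'\<bar> * w + \<bar>\<alpha>'\<bar> * w"
    using mult_left_mono[OF le(1), of "\<bar>\<beta>'\<bar>"] mult_left_mono[OF le(2), of "\<bar>\<alpha>'\<bar>"]
    by (intro order_trans[OF abs_triangle_ineq4]) (simp add: abs_mult)
  finally have 1: "norm x \<le> (\<bar>\<alpha>'\<bar> + \<bar>\<beta>'\<bar>) / ?\<Delta> * w"
    using assms(1) by (simp add: field_simps)
  have "norm u \<le> \<bar>\<alpha>\<bar> * norm x + \<bar>\<beta>\<bar> * norm x"
    unfolding u using norm_triangle_ineq[of "\<alpha> *\<^sub>R x" "\<beta> *\<^sub>R y"] n by simp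
  also have "\<dots> = (\<bar>\<alpha>\<bar> + \<bar>\<beta>\<bar>) * norm x" by (simp add: algebra_simps)
  also have "\<dots> \<le> (\<bar>\<alpha>\<bar> + \<bar>\<beta>\<bar>) * ((\<bar>\<alpha>'\<bar> + \<bar>\<beta>'\<bar>) / ?\<Delta> * w)"
    by (intro mult_left_mono 1) simp
  finally show "norm u \<le> (\<bar>\<alpha>\<bar> + \<bar>\<beta>\<bar>) * ((\<bar>\<alpha>'\<bar> + \<bar>\<beta>'\<bar>) / ?\<Delta>) * norm (u + v)"
    unfolding w_def by (simp only: mult.assoc)
qed

lemma subspace_cramer:
  assumes "subspace Z" "\<alpha> *\<^sub>R x + \<beta> *\<^sub>R y \<in> Z" "\<alpha>' *\<^sub>R x + \<beta>' *\<^sub>R y \<in> Z" "\<alpha> * \<beta>' \<noteq> \<alpha>' * \<beta>"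
  shows "x \<in> Z" "y \<in> Z"
proof -
  let ?d = "\<alpha> * \<beta>' - \<alpha>' * \<beta>"
  let ?p = "\<alpha> *\<^sub>R x + \<beta> *\<^sub>R y" and ?q = "\<alpha>' *\<^sub>R x + \<beta>' *\<^sub>R y"
  have d: "?d \<noteq> 0" using assms(4) by simp
  have "\<beta>' *\<^sub>R ?p - \<beta> *\<^sub>R ?q = ?d *\<^sub>R x" "\<alpha> *\<^sub>R ?q - \<alpha>' *\<^sub>R ?p = ?d *\<^sub>R y"
    by (simp_all add: algebra_simps)
  moreover have "\<beta>' *\<^sub>R ?p - \<beta> *\<^sub>R ?q \<in> Z" "\<alpha> *\<^sub>R ?q - \<alpha>' *\<^sub>R ?p \<in> Z"
    by (intro subspace_diff subspace_scale assms)+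
  ultimately have "(1 / ?d) *\<^sub>R (?d *\<^sub>R x) \<in> Z" "(1 / ?d) *\<^sub>R (?d *\<^sub>R y) \<in> Z"
    using assms(1) by (metis subspace_scale)+
  then show "x \<in> Z" "y \<in> Z" using d by simp_all
qed

text \<open>
  If the two index maps agree, the generators with index \<open>i\<close> determine \<open>e\<^sub>i\<close> and \<open>f\<^sub>\<sigma>\<^sub>(\<^sub>i\<^sub>)\<close>. If one of
  them is the shift, the generators form a chain \<open>f\<^sub>0, e\<^sub>0, f\<^sub>1, e\<^sub>1, \<dots>\<close> in which each vector is
  obtained from the one before it, and \<open>f\<^sub>0\<close> starts the chain; the chain breaks only when a
  coefficient vanishes, and then all basis vectors are reached directly.
\<close>

lemma slanted_pair_dense:
  assumes Z: "subspace Z" "closed Z" "f 0 \<in> Z"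
    and sub: "slanted \<alpha> \<beta> \<sigma> \<subseteq> Z" "slanted \<alpha>' \<beta>' \<sigma>' \<subseteq> Z"
    and det: "\<alpha> * \<beta>' \<noteq> \<alpha>' * \<beta>" and \<sigma>: "\<sigma> \<in> {id, Suc}" "\<sigma>' \<in> {id, Suc}"
  shows "Z = UNIV"
proof -
  have mixed: "e i \<in> Z \<and> f i \<in> Z"
    if g: "\<And>i. \<alpha> *\<^sub>R e i + \<beta> *\<^sub>R f i \<in> Z" "\<And>i. \<alpha>' *\<^sub>R e i + \<beta>' *\<^sub>R f (Suc i) \<in> Z"
      and det: "\<alpha> * \<beta>' \<noteq> \<alpha>' * \<beta>" for \<alpha> \<beta> \<alpha>' \<beta>' i
  proof (cases "\<alpha> = 0 \<or> \<beta>' = 0")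
    case True
    then consider "\<alpha> = 0" "\<beta> \<noteq> 0" "\<alpha>' \<noteq> 0" | "\<beta>' = 0" "\<beta> \<noteq> 0" "\<alpha>' \<noteq> 0" using det by auto
    then show ?thesis
    proof cases
      case 1
      have f: "f i \<in> Z" for i using subspace_scale[OF Z(1) g(1)[of i], of "1 / \<beta>"] 1 by simp
      then show ?thesis
        using subspace_cramer(1)[OF Z(1) g(2)[of i], of 0 1] f[of "Suc i"] 1 by simp
    next
      case 2
      have e: "e i \<in> Z" for i using subspace_scale[OF Z(1) g(2)[of i], of "1 / \<alpha>'"] 2 by simp
      then show ?thesis
        using subspace_cramer(2)[OF Z(1) g(1)[of i], of 1 0] e[of i] 2 by simp
    qed
  next
    case False
    have e: "e i \<in> Z" if "f i \<in> Z" for i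
      using subspace_cramer(1)[OF Z(1) g(1)[of i], of 0 1] that False by simp
    have f: "f (Suc i) \<in> Z" if "e i \<in> Z" for i
      using subspace_cramer(2)[OF Z(1) g(2)[of i], of 1 0] that False by simp
    have "f i \<in> Z" by (induction i) (simp_all add: Z e f)
    then show ?thesis using e by simp
  qed
  have g: "\<alpha> *\<^sub>R e i + \<beta> *\<^sub>R f (\<sigma> i) \<in> Z" "\<alpha>' *\<^sub>R e i + \<beta>' *\<^sub>R f (\<sigma>' i) \<in> Z" for i
    using sub slanted_generator by blast+
  have "e i \<in> Z \<and> f i \<in> Z" for i
  proof -
    consider "\<sigma> = \<sigma>'" | "\<sigma> = id" "\<sigma>' = Suc" | "\<sigma> = Suc" "\<sigma>' = id" using \<sigma> by auto
    then show ?thesis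
    proof cases
      case 1
      have *: "e i \<in> Z" "f (\<sigma> i) \<in> Z" for i
        using subspace_cramer[OF Z(1) g(1)[of i] g(2)[of i, folded 1] det] by auto
      moreover have "f i \<in> Z" using \<sigma>(1) *(2)[of i] *(2)[of "i - 1"] Z(3) by (cases i) auto
      ultimately show ?thesis by blast
    next
      case 2
      then show ?thesis using mixed[of \<alpha> \<beta> \<alpha>' \<beta>' i] g det by simp
    next
      case 3
      then show ?thesis using mixed[of \<alpha>' \<beta>' \<alpha> \<beta> i] g det by (simp add: mult.commute)
    qed
  qed
  then show ?thesis using basis_dense[OF Z(1,2)] by blast
qed

section \<open>The six atoms\<close>

lemma slanted_pair_sum:
  assumes "positive_angle (slanted \<alpha> \<beta> \<sigma>) (slanted \<alpha>' \<beta>' \<sigma>')"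
    and "\<alpha> * \<beta>' \<noteq> \<alpha>' * \<beta>" "\<sigma> \<in> {id, Suc}" "\<sigma>' \<in> {id, Suc}"
  shows "slanted \<alpha> \<beta> \<sigma> + slanted \<alpha>' \<beta>' \<sigma>' + span {f 0} = UNIV"
proof (rule slanted_pair_dense[OF _ _ _ _ _ assms(2-4)])
  let ?S = "slanted \<alpha> \<beta> \<sigma> + slanted \<alpha>' \<beta>' \<sigma>'"
  have S: "subspace ?S" "closed ?S"
    using assms(1) by (simp_all add: subspace_set_plus closed_set_plus)
  then show Z: "subspace (?S + span {f 0})" "closed (?S + span {f 0})"
    by (simp_all add: subspace_set_plus closed_plus_finite)
  have sub: "?S \<subseteq> ?S + span {f 0}" by (simp add: subset_set_plus_left)
  show "f 0 \<in> ?S + span {f 0}"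
    using subset_set_plus_right[OF S(1), of "span {f 0}"] span_base[of "f 0" "{f 0}"] by blast
  have "slanted \<alpha> \<beta> \<sigma> \<subseteq> ?S" "slanted \<alpha>' \<beta>' \<sigma>' \<subseteq> ?S"
    by (simp_all add: subset_set_plus_left subset_set_plus_right)
  with sub show "slanted \<alpha> \<beta> \<sigma> \<subseteq> ?S + span {f 0}" "slanted \<alpha>' \<beta>' \<sigma>' \<subseteq> ?S + span {f 0}"
    by (simp_all only: order_trans)
qed

lemma slanted_pair_transversal:
  assumes "positive_angle (slanted \<alpha> \<beta> \<sigma>) (slanted \<alpha>' \<beta>' \<sigma>')"
    and "\<alpha> * \<beta>' \<noteq> \<alpha>' * \<beta>" "\<sigma> \<in> {id, Suc}" "\<sigma>' \<in> {id, Suc}"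
  shows "transversal (slanted \<alpha> \<beta> \<sigma>) (slanted \<alpha>' \<beta>' \<sigma>')"
  using fd_congruent_sym[OF fd_congruent_plus_finite[of "{f 0}" "slanted \<alpha> \<beta> \<sigma> + slanted \<alpha>' \<beta>' \<sigma>'"]]
  unfolding transversal_def slanted_pair_sum[OF assms] using assms(1) by simp

lemma slanted_transversal:
  assumes "\<bar>\<alpha> * \<beta>'\<bar> \<noteq> \<bar>\<alpha>' * \<beta>\<bar>" "\<sigma> \<in> {id, Suc}" "\<sigma>' \<in> {id, Suc}"
  shows "transversal (slanted \<alpha> \<beta> \<sigma>) (slanted \<alpha>' \<beta>' \<sigma>')"
proof (rule slanted_pair_transversal)
  show "positive_angle (slanted \<alpha> \<beta> \<sigma>) (slanted \<alpha>' \<beta>' \<sigma>')"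
    using assms by (intro positive_angle_slanted) auto
  show "\<alpha> * \<beta>' \<noteq> \<alpha>' * \<beta>" using assms(1) by auto
qed (use assms in simp_all)

text \<open>
  The capitals stand for the subspaces \<open>a\<close>, \<open>b\<close>, \<open>c\<close> of the theorem, and a prime marks what will turn
  out to be the orthogonal complement. The subspace \<open>B0\<close> is \<open>b\<close> without its generator \<open>f\<^sub>0\<close>:
  unlike \<open>b\<close> it has a positive angle with \<open>a\<close>, and it is congruent to \<open>b\<close>, so it replaces \<open>b\<close> in the
  transversal family. The hyperplane \<open>A1\<close> of \<open>A\<close> is the subspace that \<open>b\<close> complements.
\<close>

abbreviation "A \<equiv> slanted 0 1 id"
abbreviation "A' \<equiv> slanted 1 0 id"
abbreviation "B0 \<equiv> slanted 1 (-2) Suc"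
abbreviation "B' \<equiv> slanted 2 1 Suc"
abbreviation "C \<equiv> slanted 1 1 id"
abbreviation "C' \<equiv> slanted 1 (-1) id"

definition B :: "'h set" where "B = B0 + span {f 0}"
definition A1 :: "'h set" where "A1 = slanted 0 1 Suc"

lemma orthogonal_C: "x \<in> C \<Longrightarrow> y \<in> C' \<Longrightarrow> x \<bullet> y = 0"
  unfolding slanted_def by (erule orthogonal_closed_span[rotated]) (auto simp: inner_simps)

text \<open>
  The absolute slopes are \<open>\<infinity>\<close>, \<open>0\<close>, \<open>2\<close>, \<open>1/2\<close>, \<open>1\<close>, \<open>1\<close> in the order \<open>A\<close>, \<open>A'\<close>, \<open>B0\<close>, \<open>B'\<close>, \<open>C\<close>, \<open>C'\<close>;
  only \<open>C\<close> and \<open>C'\<close> coincide, and these are orthogonal.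
\<close>

lemma transversals:
  "transversal A A'" "transversal A B0" "transversal A B'" "transversal A C" "transversal A C'"
  "transversal A' B0" "transversal A' B'" "transversal A' C" "transversal A' C'"
  "transversal B0 B'" "transversal B0 C" "transversal B0 C'"
  "transversal B' C" "transversal B' C'" "transversal C C'"
  using slanted_pair_transversal[OF positive_angle_orthogonal[OF orthogonal_C]]
  by (simp_all add: slanted_transversal)

lemma subspace_B [simp]: "subspace B" and closed_B [simp]: "closed B"
  by (simp_all add: B_def subspace_set_plus closed_plus_finite)

lemma f0_membership: "f 0 \<in> A" "f 0 \<in> B" "f 0 \<notin> A1"
proof -
  show "f 0 \<in> A" using slanted_generator[of 0 0 1 id] by simp
  show "f 0 \<in> B"
    unfolding B_def
    using subset_set_plus_right[OF subspace_slanted, of "span {f 0}" 1 "-2" Suc]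
      span_base[of "f 0" "{f 0}"] by blast
  have "x \<bullet> y = 0" if "x \<in> closed_span {f 0}" "y \<in> A1" for x y
    by (rule orthogonal_closed_span[OF _ that[unfolded A1_def slanted_def]]) auto
  then show "f 0 \<notin> A1" using subset_closed_span[of "{f 0}"] inner_basis(2)[of 0 0] by force
qed

lemma B_closed_span: "B = closed_span ({f 0} \<union> {e i - 2 *\<^sub>R f (i + 1) | i. True})"
proof
  let ?Z = "closed_span ({f 0} \<union> {e i - 2 *\<^sub>R f (i + 1) | i. True})"
  have gen: "range (\<lambda>i. 1 *\<^sub>R e i + (-2) *\<^sub>R f (Suc i)) = {e i - 2 *\<^sub>R f (i + 1) | i. True}" by auto
  have "B0 \<subseteq> ?Z"
    unfolding slanted_def gen
    by (intro closed_span_minimal) (auto intro!: subsetD[OF subset_closed_span])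
  moreover have "span {f 0} \<subseteq> ?Z"
    by (intro span_minimal) (auto intro!: subsetD[OF subset_closed_span])
  ultimately show "B \<subseteq> ?Z" unfolding B_def by (simp add: set_plus_subspace_least)
  have "B0 \<subseteq> B" unfolding B_def by (simp add: subset_set_plus_left)
  moreover have "{e i - 2 *\<^sub>R f (i + 1) | i. True} \<subseteq> B0"
    unfolding slanted_def gen by (rule subset_closed_span)
  ultimately show "?Z \<subseteq> B" using f0_membership by (intro closed_span_minimal) auto
qed

lemma A_decomposition: "A = A1 + span {f 0}"
proof
  have sub: "subspace (A1 + span {f 0})" "closed (A1 + span {f 0})"
    by (simp_all add: A1_def subspace_set_plus closed_plus_finite)
  have "f i \<in> A1 + span {f 0}" for i
  proof (cases i)
    case 0
    then show ?thesis
      using subset_set_plus_right[of A1 "span {f 0}"] span_base[of "f 0" "{f 0}"] by (auto simp: A1_def)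
  next
    case (Suc j)
    then have "f i \<in> A1" using slanted_generator[of 0 j 1 Suc] by (simp add: A1_def)
    then show ?thesis using subset_set_plus_left[of "span {f 0}" A1] by auto
  qed
  then show "A \<subseteq> A1 + span {f 0}"
    using sub unfolding slanted_def[of 0 1 id] by (intro closed_span_minimal) auto
  have "f i \<in> A" for i using slanted_generator[of 0 i 1 id] by simp
  then have "range (\<lambda>i. f (Suc i)) \<subseteq> A" "{f 0} \<subseteq> A" by auto
  then have "A1 \<subseteq> A" "span {f 0} \<subseteq> A"
    unfolding A1_def slanted_def[of 0 1 Suc] by (simp_all add: closed_span_minimal span_minimal)
  then show "A1 + span {f 0} \<subseteq> A" by (simp add: set_plus_subspace_least)
qed

lemma subspace_A1 [simp]: "subspace A1" and closed_A1 [simp]: "closed A1"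
  by (simp_all add: A1_def)

lemma A1_subset: "A1 \<subseteq> A"
  unfolding A_decomposition by (simp add: subset_set_plus_left)

text \<open>
  Two transversal slanted subspaces fill the space except possibly for the direction of \<open>f\<^sub>0\<close>, the
  one basis vector that the generators need not produce.
\<close>

lemma slanted_pair_sum_UNIV:
  assumes "transversal (slanted \<alpha> \<beta> \<sigma>) (slanted \<alpha>' \<beta>' \<sigma>')"
    and "\<alpha> * \<beta>' \<noteq> \<alpha>' * \<beta>" "\<sigma> \<in> {id, Suc}" "\<sigma>' \<in> {id, Suc}"
    and "f 0 \<in> slanted \<alpha> \<beta> \<sigma> + slanted \<alpha>' \<beta>' \<sigma>'"
  shows "slanted \<alpha> \<beta> \<sigma> + slanted \<alpha>' \<beta>' \<sigma>' = UNIV"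
proof -
  let ?S = "slanted \<alpha> \<beta> \<sigma> + slanted \<alpha>' \<beta>' \<sigma>'"
  have "?S + span {f 0} = UNIV"
    using assms unfolding transversal_def by (intro slanted_pair_sum) auto
  moreover have "?S + span {f 0} \<subseteq> ?S"
  proof (rule set_plus_subspace_least)
    show S: "subspace ?S" by (simp add: subspace_set_plus)
    show "span {f 0} \<subseteq> ?S" using assms(5) S by (simp add: span_minimal)
  qed simp
  ultimately show ?thesis by auto
qed

lemma A_sums: "A + A' = UNIV" "A + B0 = UNIV" "A + B' = UNIV" "A + C = UNIV" "A + C' = UNIV"
  using transversals f0_membership(1) by (intro slanted_pair_sum_UNIV; simp add: subsetD[OF subset_set_plus_left])+

lemma C_sums: "A' + C = UNIV" "C + C' = UNIV"
proof -
  have e: "e 0 \<in> A'" and c: "e 0 + f 0 \<in> C" and c': "e 0 - f 0 \<in> C'"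
    using slanted_generator[of 1 0 0 id] slanted_generator[of 1 0 1 id] slanted_generator[of 1 0 "-1" id]
    by simp_all
  \<comment> \<open>In both sums \<open>f\<^sub>0\<close> is a combination of generators with index \<open>0\<close>.\<close>
  have "- e 0 + (e 0 + f 0) \<in> A' + C"
    using e c by (intro set_plus_intro subspace_neg) auto
  then show "A' + C = UNIV" using transversals by (intro slanted_pair_sum_UNIV) auto
  have "(1/2) *\<^sub>R (e 0 + f 0) + (- (1/2)) *\<^sub>R (e 0 - f 0) \<in> C + C'"
    using c c' by (intro set_plus_intro subspace_scale) auto
  moreover have "(1/2) *\<^sub>R (e 0 + f 0) + (- (1/2)) *\<^sub>R (e 0 - f 0) = f 0"
    by (simp add: algebra_simps flip: scaleR_add_left)
  ultimately show "C + C' = UNIV" using transversals by (intro slanted_pair_sum_UNIV) auto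
qed

lemma B_sums: "B + A' = UNIV" "B + B' = UNIV" "B + C = UNIV" "B + C' = UNIV"
proof -
  have "B0 + slanted \<alpha> \<beta> \<sigma> + span {f 0} = UNIV"
    if "transversal B0 (slanted \<alpha> \<beta> \<sigma>)" "\<beta> \<noteq> - 2 * \<alpha>" "\<sigma> \<in> {id, Suc}" for \<alpha> \<beta> \<sigma>
    using that unfolding transversal_def by (intro slanted_pair_sum) auto
  then show "B + A' = UNIV" "B + B' = UNIV" "B + C = UNIV" "B + C' = UNIV"
    using transversals transversals(6)[THEN transversal_sym]
    unfolding B_def by (simp_all add: ac_simps)
qed

text \<open>
  Moving \<open>f\<^sub>0\<close> from \<open>A\<close> to \<open>B0\<close> turns the decomposition \<open>A + B0\<close> into \<open>A1 + B\<close>.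
\<close>

lemma A1_B_complement: "A1 + B = UNIV" "A1 \<inter> B = {0}"
proof -
  have "A1 + B = A + B0" unfolding A_decomposition B_def by (simp add: ac_simps)
  then show "A1 + B = UNIV" using A_sums by simp
  have "w = 0" if mem: "w \<in> A1" "w \<in> B" for w
  proof -
    obtain v k where v: "v \<in> B0" and w: "w = v + k *\<^sub>R f 0"
      using mem(2) unfolding B_def by (auto simp: mem_set_plus span_singleton)
    have "w - k *\<^sub>R f 0 \<in> A"
      using mem(1) A1_subset f0_membership(1) by (intro subspace_diff subspace_scale) auto
    then have "v \<in> A \<inter> B0" using v w by simp
    then have "v = 0"
      using transversal_Int[OF transversals(2)] by simp
    then have kA1: "k *\<^sub>R f 0 \<in> A1" using w mem by simp
    have "k = 0"
    proof (rule ccontr)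
      assume "k \<noteq> 0"
      then have "f 0 \<in> A1" using subspace_scale[OF _ kA1, of "1 / k"] by simp
      then show False using f0_membership(3) by blast
    qed
    then show "w = 0" using w \<open>v = 0\<close> by simp
  qed
  then show "A1 \<inter> B = {0}" by (auto simp: subspace_0)
qed

lemma orthogonal_A: "x \<in> A \<Longrightarrow> y \<in> A' \<Longrightarrow> x \<bullet> y = 0"
  unfolding slanted_def by (erule orthogonal_closed_span[rotated]) auto

lemma orthogonal_B: "x \<in> B \<Longrightarrow> y \<in> B' \<Longrightarrow> x \<bullet> y = 0"
  unfolding slanted_def B_closed_span by (erule orthogonal_closed_span[rotated]) (auto simp: inner_simps)

lemma orthogonal_complements: "A\<^sup>\<bottom> = A'" "B\<^sup>\<bottom> = B'" "C\<^sup>\<bottom> = C'"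
  by (intro orthogonal_comp_eq; simp add: orthogonal_A orthogonal_B orthogonal_C A_sums B_sums C_sums)+

text \<open>
  A common vector of \<open>B\<close> and \<open>A'\<close> is orthogonal to \<open>B'\<close> and to \<open>A\<close>, which together span the space.
\<close>

lemma B_Int_A': "B \<inter> A' = {0}"
proof -
  have "w = 0" if "w \<in> B" "w \<in> A'" for w
  proof -
    obtain x y where xy: "x \<in> A" "y \<in> B'" "w = x + y"
      using A_sums(3) by (metis UNIV_I set_plus_elim)
    have "x \<bullet> w = 0" "w \<bullet> y = 0" using xy that orthogonal_A orthogonal_B by auto
    then have "w \<bullet> w = 0" unfolding xy(3) by (simp add: inner_simps inner_commute)
    then show ?thesis by simp
  qed
  then show ?thesis by (auto simp: subspace_0)
qed

definition family :: "'h set set" where "family = {A, A', B0, B', C, C'}"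

sublocale transversal_family family
proof
  show "subspace m \<and> closed m" if "m \<in> family" for m using that unfolding family_def by auto
  show "transversal m n" if "m \<in> family" "n \<in> family" "m \<noteq> n" for m n
    using that transversals transversals[THEN transversal_sym] unfolding family_def by blast
  have "A \<inter> A' = {0}"
    using transversals(1) by (simp add: transversal_Int)
  moreover have "f 0 \<noteq> 0" using inner_basis(2)[of 0 0] by force
  ultimately have "A \<noteq> A'" using f0_membership(1) by auto
  then show "\<exists>n\<in>family. n \<noteq> m" if "m \<in> family" for m unfolding family_def by (cases "m = A") auto
qed

lemma fd_congruent_B: "fd_congruent B B0"
  unfolding B_def by (simp add: fd_congruent_plus_finite)

text \<open>
  Only the congruence classes of the generating subspaces matter, so \<open>B0\<close> may stand for \<open>B\<close>.
\<close>

lemma saturation_eq: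
  "fd_saturation {{0}, A, A', B, B', C, C', UNIV} = saturation"
proof (rule fd_saturation_cong)
  note B = fd_congruent_B fd_congruent_B[THEN fd_congruent_sym]
  show "\<exists>n\<in>insert {0} (insert UNIV family). fd_congruent m n" if "m \<in> {{0}, A, A', B, B', C, C', UNIV}" for m
  proof (cases "m = B")
    case True
    then show ?thesis using B by (intro bexI[of _ B0]) (auto simp: family_def)
  next
    case False
    then have "m \<in> insert {0} (insert UNIV family)" using that unfolding family_def by auto
    then show ?thesis using fd_congruent_refl by (intro bexI[of _ m])
  qed
  show "\<exists>m\<in>{{0}, A, A', B, B', C, C', UNIV}. fd_congruent n m" if "n \<in> insert {0} (insert UNIV family)" for n
  proof (cases "n = B0")
    case True
    then show ?thesis using B by (intro bexI[of _ B]) auto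
  next
    case False
    then have "n \<in> {{0}, A, A', B, B', C, C', UNIV}" using that unfolding family_def by auto
    then show ?thesis using fd_congruent_refl by (intro bexI[of _ n])
  qed
qed

lemma members_carrier:
  "A \<in> carrier saturation" "A' \<in> carrier saturation" "C \<in> carrier saturation"
  "B \<in> carrier saturation" "A1 \<in> carrier saturation"
proof -
  have *: "m \<in> carrier saturation" if "subspace m" "closed m" "n \<in> family" "fd_congruent m n" for m n
    using that unfolding fd_saturation_simps by (intro conjI bexI[of _ n]) auto
  show "A \<in> carrier saturation" "A' \<in> carrier saturation" "C \<in> carrier saturation"
    by (rule *[OF _ _ _ fd_congruent_refl]; simp add: family_def)+
  show "B \<in> carrier saturation" by (rule *[OF _ _ _ fd_congruent_B]) (simp_all add: family_def)
  have "fd_congruent A1 A"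
    unfolding A_decomposition by (rule fd_congruent_sym[OF fd_congruent_plus_finite]) simp
  then show "A1 \<in> carrier saturation" by (rule *[rotated 3]) (simp_all add: family_def)
qed

section \<open>Failure of normality\<close>

lemma infinite_dimensional: "\<not> almost_in A1 {0}" "\<not> almost_in B0 {0}"
proof -
  have "range (\<lambda>i. f (Suc i)) \<subseteq> A1"
    unfolding A1_def using slanted_generator[of 0 _ 1 Suc] by auto
  moreover have "f i \<noteq> 0" for i using inner_basis(2)[of i i] by force
  ultimately show "\<not> almost_in A1 {0}"
    by (intro not_almost_in_zero[of "\<lambda>i. f (Suc i)"]) simp_all
  let ?g = "\<lambda>i. 1 *\<^sub>R e i + (-2) *\<^sub>R f (Suc i)"
  show "\<not> almost_in B0 {0}"
  proof (rule not_almost_in_zero)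
    show "range ?g \<subseteq> B0" using slanted_generator[of 1 _ "-2" Suc] by blast
    show "?g i \<bullet> ?g j = 0" if "i \<noteq> j" for i j using that by (simp add: inner_simps)
    have "?g i \<bullet> ?g i = 5" for i by (simp add: inner_simps)
    then show "?g i \<noteq> 0" for i by (metis inner_zero_left zero_neq_numeral)
  qed
qed

text \<open>
  The model \<open>m\<close> of \<open>t\<close> decides the case. A finite-dimensional \<open>t\<close> would make \<open>B\<close> almost everything,
  leaving no room for \<open>A1\<close>; and \<open>t\<close> cannot almost contain the infinite-dimensional subspaces \<open>A1\<close>
  or \<open>B0\<close>, which it meets in \<open>0\<close>. In the remaining cases \<open>m\<close> complements both \<open>A\<close> and \<open>B\<close>, and the
  index argument identifies \<open>A1\<close> with \<open>A\<close>.
\<close>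

lemma no_common_complement:
  assumes t: "t \<in> carrier saturation"
    and A1: "A1 \<inter> t = {0}" "A1 + t = UNIV" and B: "B \<inter> t = {0}" "B + t = UNIV"
  shows False
proof -
  obtain m where m: "m \<in> insert {0} (insert UNIV family)" "fd_congruent t m" using t by auto
  have sub: "subspace t" "subspace m" using t m member by auto
  have al: "almost_in t m" "almost_in m t" using m(2) sub by (simp_all add: fd_congruent_iff)
  consider "m = {0}" | "A1 \<subseteq> m" | "m = B0" | "m \<in> {A', B', C, C'}"
    using m(1) A1_subset unfolding family_def by blast
  then show False
  proof cases
    case 1
    then have "almost_in (B + t) (B + {0})"
      using al by (intro almost_in_plus) (auto simp: almost_in_subset)
    then have "almost_in UNIV B" using B(2) by simp
    then have "almost_in A1 B" by (rule almost_in_trans[OF almost_in_subset, rotated]) simp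
    then show False
      using almost_in_zero_if_disjoint[OF _ _ _ A1_B_complement(2)] infinite_dimensional by simp
  next
    case 2
    then have "almost_in A1 t" using al(2) by (blast intro: almost_in_trans almost_in_subset)
    then show False
      using almost_in_zero_if_disjoint[OF _ sub(1) _ A1(1)] infinite_dimensional by simp
  next
    case 3
    have "B0 \<subseteq> B" unfolding B_def by (simp add: subset_set_plus_left)
    then have "B0 \<inter> t = {0}" using B(1) sub by (auto simp: subspace_0)
    then show False
      using almost_in_zero_if_disjoint[OF _ sub(1), of B0] al(2) 3 infinite_dimensional by simp
  next
    case 4
    then have "transversal A m" using transversals by auto
    then have "A \<inter> m = {0}" using sub by (simp add: transversal_Int)
    moreover have "B + m = UNIV" using 4 B_sums by auto
    ultimately have "A1 = A"
      using common_almost_complement_unique[of A1 A B m t] sub al B(1) A1(2) A1_subset by simp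
    then show False using f0_membership by simp
  qed
qed

text \<open>
  The chain of common complements \<open>B\<close>, \<open>C\<close>, \<open>A'\<close> connects \<open>A1\<close> with \<open>A'\<close>, then \<open>A\<close>, then \<open>B\<close>.
  Since \<open>A1\<close> and \<open>B\<close> are themselves complementary, any axis of perspectivity between them is a
  common complement of the two.
\<close>

lemma not_normal_saturation: "\<not> normal_lattice saturation"
proof
  assume "normal_lattice saturation"
  then obtain R where "normal_equivalence saturation R" unfolding normal_lattice_def by blast
  then have equiv: "equiv (carrier saturation) R"
    and E2: "\<And>x y. x \<in> carrier saturation \<Longrightarrow> y \<in> carrier saturation \<Longrightarrow>
        perspective saturation x y \<Longrightarrow> (x, y) \<in> R"
    and E3: "\<And>x y. x \<in> carrier saturation \<Longrightarrow> y \<in> carrier saturation \<Longrightarrow>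
        independent_in saturation x y \<Longrightarrow> (x, y) \<in> R \<Longrightarrow> perspective saturation x y"
    unfolding normal_equivalence_def by blast+
  have Int: "A \<inter> A' = {0}" "A \<inter> C = {0}" "A' \<inter> C = {0}"
    using transversals by (simp_all add: transversal_Int)
  have "(A1, A') \<in> R"
    using B_sums A1_B_complement B_Int_A' members_carrier
    by (intro E2 perspectiveI_common_complement[of B]) (simp_all add: Int_commute add.commute)
  moreover have "(A', A) \<in> R"
    using Int A_sums C_sums members_carrier
    by (intro E2 perspectiveI_common_complement[of C]) simp_all
  moreover have "(A, B) \<in> R"
    using Int A_sums B_sums B_Int_A' members_carrier
    by (intro E2 perspectiveI_common_complement[of A']) simp_all
  ultimately have "(A1, B) \<in> R"
    using equiv unfolding equiv_def trans_def by blast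
  then have "perspective saturation A1 B"
    using members_carrier A1_B_complement by (intro E3) (simp_all add: independent_in_def)
  then obtain t where t: "t \<in> carrier saturation" "A1 \<inter> t = B \<inter> t"
    "ljoin saturation A1 t = ljoin saturation B t"
    unfolding perspective_def fd_saturation_simps(1) by blast
  then have sum: "A1 + t = B + t" using members_carrier by (simp only: ljoin_carrier)
  have "subspace t" using t(1) fd_saturation_simps(4) by blast
  have "A1 \<inter> t \<subseteq> A1 \<inter> B" using t(2) by blast
  then have "A1 \<inter> t = {0}" using A1_B_complement(2) \<open>subspace t\<close> by (auto simp: subspace_0)
  \<comment> \<open>The join of \<open>A1\<close> and \<open>t\<close> contains \<open>B\<close> as well, so it is everything.\<close>
  moreover have "A1 + B \<subseteq> A1 + t"
    using sum \<open>subspace t\<close>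
    by (metis set_plus_subspace_least subset_set_plus_left subspace_A1 subspace_set_plus)
  then have "A1 + t = UNIV" using A1_B_complement(1) by auto
  ultimately show False using no_common_complement[OF t(1)] t(2) sum by simp
qed

end

theorem theorem10p24:
  fixes e f :: "nat \<Rightarrow> 'h::{real_inner, complete_space}"
    and a b c :: "'h set"
    and M :: "'h set set"
    and L :: "'h set zlattice"
  assumes "orthonormal_basis (case_sum e f)"
    and "a = closed_span {f i | i. True}"
    and "b = closed_span ({f 0} \<union> {e i - 2 *\<^sub>R f (i + 1) | i. True})"
    and "c = closed_span {e i + f i | i. True}"
    and "M = {{0}, a, a\<^sup>\<bottom>, b, b\<^sup>\<bottom>, c, c\<^sup>\<bottom>, UNIV}"
    and "L = fd_saturation M"
  shows "complemented_modular_lattice L \<and> \<not> normal_lattice L"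
proof -
  interpret paired_orthonormal_basis e f using assms(1) by unfold_locales
  have "a = A" "c = C" unfolding assms(2,4) slanted_def by (simp_all add: full_SetCompr_eq)
  moreover have "b = B" using assms(3) B_closed_span by simp
  ultimately have "L = saturation"
    using assms(5,6) orthogonal_complements saturation_eq by simp
  then show ?thesis using complemented_modular_saturation not_normal_saturation by simp
qed

end
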